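(* Let $d\ge 1$ and $\sigma>0$. There exist constants $C,c_1,c_2>0$, depending only on $d$ and $\sigma$, such that for all $x,y\in\mathbb{R}^d$ $$ C^{-1}\,Y_\sigma(x,y)\exp\big(-c_1\|x-y\|(\|x\|+\|y\|)\big)\le \mathcal K^\sigma(x,y)\le C\,Y_\sigma(x,y)\exp\big(-c_2\|x-y\|(\|x\|+\|y\|)\big), $$ where $$ Y_\sigma(x,y)=\begin{cases} \|x-y\|^{2\sigma-d}, & \sigma<d/2,\\ 1+\log^+\frac{1}{\|x-y\|(\|x\|+\|y\|)}, & \sigma=d/2,\\ (1+\|x+y\|)^{d-2\sigma}, & \sigma>d/2. \end{cases} $$
   Context: $\|\cdot\|$ is the Euclidean norm on $\mathbb{R}^d$. For $t>0$ and $x,y\in\mathbb{R}^d$ let $$ G_t(x,y)=\big(2\pi\sinh(2t)\big)^{-d/2}\exp\Big(-\tfrac14\big[\tanh(t)\|x+y\|^2+\coth(t)\|x-y\|^2\big]\Big), $$ which is the integral kernel of the semigroup $\exp(-t\mathcal H)$ generated by the harmonic oscillator $\mathcal H=-\Delta+\|x\|^2$ on $\mathbb{R}^d$. The potential kernel is $$ \mathcal K^\sigma(x,y)=\frac1{\Gamma(\sigma)}\int_0^\infty G_t(x,y)\,t^{\sigma-1}\,dt\in(0,\infty]. $$ $\log^+=\max(\log,0)$ is the positive part of the logarithm. Conventions: $0^{a}=\infty$ for $a<0$, $1/0=\infty$, $\log^+\infty=\infty$; thus for $x=y$ and $\sigma\le d/2$ one has $Y_\sigma(x,x)=\infty$ and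 the estimate is read as $\mathcal K^\sigma(x,x)=\infty$. *)

theory Defs
  imports "HOL-Analysis.Analysis"
begin

text \<open>The space \<open>\<real>\<^sup>d\<close> is \<open>real ^ 'n\<close> with \<open>d = CARD('n) \<ge> 1\<close>; its \<open>norm\<close> is the Euclidean one.\<close>

definition coth :: "real \<Rightarrow> real" where
  "coth t = cosh t / sinh t"

definition mehler_kernel :: "real \<Rightarrow> real ^ 'n \<Rightarrow> real ^ 'n \<Rightarrow> real" where
  "mehler_kernel t x y =
     (2 * pi * sinh (2 * t)) powr (- real CARD('n) / 2) *
     exp (- (1 / 4) * (tanh t * (norm (x + y))\<^sup>2 + coth t * (norm (x - y))\<^sup>2))"

text \<open>The potential kernel takes values in \<open>[0, \<infinity>]\<close>, so the integral is the nonnegative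
  Lebesgue integral.\<close>

definition potential_kernel :: "real \<Rightarrow> real ^ 'n \<Rightarrow> real ^ 'n \<Rightarrow> ennreal" where
  "potential_kernel \<sigma> x y =
     ennreal (1 / Gamma \<sigma>) *
     (\<integral>\<^sup>+t\<in>{0<..}. ennreal (mehler_kernel t x y * t powr (\<sigma> - 1)) \<partial>lborel)"

text \<open>Real powers of \<open>r \<ge> 0\<close> with the convention \<open>0\<^sup>a = \<infinity>\<close> for \<open>a < 0\<close>
  (whereas \<open>0 powr a = 0\<close>).\<close>

definition ext_power :: "real \<Rightarrow> real \<Rightarrow> ennreal" where
  "ext_power r a = (if r = 0 \<and> a < 0 then \<infinity> else ennreal (r powr a))"

text \<open>The positive part of the logarithm with \<open>log\<^sup>+ \<infinity> = \<infinity>\<close>; at \<open>0\<close> it is \<open>0\<close>, since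
  \<open>ln 0 = 0\<close> in the library.\<close>

definition log_plus :: "ennreal \<Rightarrow> ennreal" where
  "log_plus z = (if z = \<infinity> then \<infinity> else ennreal (max (ln (enn2real z)) 0))"

text \<open>In the case \<open>\<sigma> = d / 2\<close> the division is that of \<^typ>\<open>ennreal\<close>, where \<open>1 / 0 = \<infinity>\<close>.\<close>

definition Y_fun :: "real \<Rightarrow> real ^ 'n \<Rightarrow> real ^ 'n \<Rightarrow> ennreal" where
  "Y_fun \<sigma> x y =
     (if \<sigma> < real CARD('n) / 2 then
        ext_power (norm (x - y)) (2 * \<sigma> - real CARD('n))
      else if \<sigma> = real CARD('n) / 2 then
        1 + log_plus (1 / ennreal (norm (x - y) * (norm x + norm y)))
      else
        ennreal ((1 + norm (x + y)) powr (real CARD('n) - 2 * \<sigma>)))"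

end

theory Submission
  imports Defs
begin

text \<open>Put \<open>a = \<parallel>x + y\<parallel>\<close>, \<open>b = \<parallel>x - y\<parallel>\<close>, \<open>M = b (\<parallel>x\<parallel> + \<parallel>y\<parallel>)\<close>, \<open>\<nu> = d / 2\<close> and \<open>s = \<sigma> - \<nu>\<close>. The kernel depends
  only on \<open>a\<close> and \<open>b\<close>, and \<open>max (a b) (b\<^sup>2) \<le> M \<le> a b + b\<^sup>2\<close>.

  For the upper bound, half of the exponent \<open>tanh t a\<^sup>2 + coth t b\<^sup>2\<close> already yields the factor
  \<open>exp (- M / 12)\<close>, uniformly in \<open>t\<close>. The other half effectively
  confines \<open>t\<close> to \<open>b\<^sup>2 \<le> t \<le> 1 / (1 + a\<^sup>2)\<close>, and what is left is the integral of \<open>t powr (s - 1)\<close>: for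
  \<open>s < 0\<close> only the lower cutoff is used, for \<open>s > 0\<close> only the upper one, for \<open>s = 0\<close> both.

  For the lower bound it suffices to integrate over one interval \<open>[\<tau>, 2 \<tau>]\<close> on which the exponent is
  \<open>O(1 + M)\<close>. One can take \<open>\<tau> = b\<^sup>2 / (1 + M)\<close> if \<open>s < 0\<close> and \<open>\<tau> = (1 + M) / (1 + a\<^sup>2)\<close> if \<open>s \<ge> 0\<close>. The
  logarithm for \<open>s = 0\<close> comes from the integral of \<open>1 / t\<close> over \<open>[b\<^sup>2, 1 / (1 + a\<^sup>2)]\<close>, and the divergence
  on the diagonal from letting the left endpoint of that interval tend to \<open>0\<close>.\<close>

section \<open>Elementary estimates\<close>

text \<open>The left side peaks at \<open>x = p / c\<close> with value
  \<open>(p / c) powr p * exp (- p)\<close>; the factor \<open>exp (- p)\<close> is given away. The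
  bound \<open>ln u \<le> u - 1\<close> at \<open>u = c / p * x\<close> replaces calculus.\<close>

lemma powr_times_exp_le:
  fixes x p c :: real
  assumes "x > 0" "p > 0" "c > 0"
  shows "x powr p * exp (- (c * x)) \<le> (p / c) powr p"
proof -
  have "ln (c / p * x) \<le> c / p * x - 1"
    using assms by (intro ln_le_minus_one) auto
  then have "p * ln (c / p * x) \<le> p * (c / p * x)"
    using assms by (intro mult_left_mono) auto
  then have "p * ln x - c * x \<le> p * ln (p / c)"
    using assms by (simp add: ln_mult ln_div algebra_simps)
  then have "exp (p * ln x - c * x) \<le> exp (p * ln (p / c))"
    by simp
  then show ?thesis
    using assms by (simp add: powr_def exp_add[symmetric])
qed

lemma nn_integral_exp_Ioi:
  fixes k :: real
  assumes "k > 0"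
  shows "(\<integral>\<^sup>+t\<in>{0<..}. ennreal (exp (- (k * t))) \<partial>lborel) = ennreal (1 / k)"
proof -
  have "((\<lambda>t. exp (- (k * t))) has_integral exp (- k * 0) / k) {0..}"
    using has_integral_exp_minus_to_infinity[OF assms, of 0] by simp
  then have "((\<lambda>t. exp (- (k * t))) has_integral (1 / k)) {0<..}"
    by (subst has_integral_spike_set_eq[of _ "{0..}"])
       (auto intro: negligible_subset[of "{0::real}"])
  then show ?thesis
    by (intro nn_integral_has_integral_lebesgue') auto
qed

lemma nn_integral_Gamma_Ioi:
  fixes s k :: real
  assumes "s > 0" "k > 0"
  shows "(\<integral>\<^sup>+t\<in>{0<..}. ennreal (t powr (s - 1) * exp (- (k * t))) \<partial>lborel)
       = ennreal (Gamma s * k powr (- s))"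
proof -
  have "((\<lambda>t. t powr (s - 1) / exp t) has_integral Gamma s) {0<..}"
    using Gamma_integral_real[OF \<open>s > 0\<close>]
    by (subst has_integral_spike_set_eq[of _ "{0..}"])
       (auto intro: negligible_subset[of "{0::real}"])
  then have G: "(\<integral>\<^sup>+t\<in>{0<..}. ennreal (t powr (s - 1) / exp t) \<partial>lborel) = ennreal (Gamma s)"
    by (intro nn_integral_has_integral_lebesgue') auto
  have "ennreal (Gamma s) =
      k * (\<integral>\<^sup>+t. ennreal ((k * t) powr (s - 1) / exp (k * t)) * indicator {0<..} (k * t) \<partial>lborel)"
    unfolding G[symmetric] using assms
    by (subst nn_integral_real_affine[where c = k and t = 0]) auto
  also have "\<dots> = (\<integral>\<^sup>+t. ennreal (k powr s) *
      (ennreal (t powr (s - 1) * exp (- (k * t))) * indicator {0<..} t) \<partial>lborel)"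
    using assms
    by (subst nn_integral_cmult[symmetric], simp, intro nn_integral_cong)
       (auto simp: indicator_def zero_less_mult_iff powr_mult exp_minus field_simps
          ennreal_mult'[symmetric] powr_diff)
  also have "\<dots> = ennreal (k powr s) *
      (\<integral>\<^sup>+t\<in>{0<..}. ennreal (t powr (s - 1) * exp (- (k * t))) \<partial>lborel)"
    by (intro nn_integral_cmult) auto
  \<comment> \<open>Multiplying both sides by the inverse power avoids a cancellation in
    \<open>ennreal\<close>.\<close>
  finally have "ennreal (k powr (- s)) * ennreal (Gamma s) = ennreal (k powr (- s)) * (ennreal (k powr s) *
      (\<integral>\<^sup>+t\<in>{0<..}. ennreal (t powr (s - 1) * exp (- (k * t))) \<partial>lborel))"
    by simp
  then show ?thesis
    using assms
    by (simp add: mult.assoc[symmetric] ennreal_mult'[symmetric] powr_add[symmetric] mult.commute)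
qed

section \<open>Bounds for hyperbolic functions\<close>

lemma sinh_ge_self:
  fixes t :: real
  assumes "t \<ge> 0"
  shows "t \<le> sinh t"
proof -
  have "sinh 0 - 0 \<le> sinh t - t"
  proof (rule DERIV_nonneg_imp_nondecreasing[OF assms])
    fix x :: real
    have "((\<lambda>x. sinh x - x) has_real_derivative (cosh x - 1)) (at x)"
      by (auto intro!: derivative_eq_intros)
    then show "\<exists>y. ((\<lambda>x. sinh x - x) has_real_derivative y) (at x) \<and> 0 \<le> y"
      using cosh_real_ge_1[of x] by auto
  qed
  then show ?thesis by simp
qed

text \<open>One bound for both ends: raised to the power \<open>- \<nu>\<close>, the factor
  \<open>t\<close> gives the singularity at 0 and \<open>exp t\<close> the decay at infinity that
  keeps the later integrals finite even for \<open>x + y = 0\<close>.\<close>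

lemma sinh_double_ge:
  fixes t :: real
  assumes "t > 0"
  shows "t * exp t \<le> sinh (2 * t)"
proof -
  have "t \<le> sinh t"
    using sinh_ge_self[of t] assms by simp
  moreover have "exp t / 2 \<le> cosh t"
    by (simp add: cosh_def)
  ultimately have "2 * (t * (exp t / 2)) \<le> 2 * (sinh t * cosh t)"
    using assms by (intro mult_left_mono mult_mono) auto
  then show ?thesis by (simp add: sinh_double)
qed

text \<open>Equivalent to \<open>1 - exp (- 2 * t) \<le> 2 * t\<close>. It controls both
  \<open>tanh t\<close> and the negative power of \<open>sinh (2 * t)\<close> in the lower
  bounds.\<close>

lemma sinh_le_times_exp:
  fixes t :: real
  shows "sinh t \<le> t * exp t"
proof -
  have "exp t * (1 - 2 * t) \<le> exp t * exp (- 2 * t)"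
    using exp_ge_add_one_self[of "- 2 * t"] by (intro mult_left_mono) auto
  also have "\<dots> = exp (- t)"
    by (simp add: exp_add[symmetric])
  finally show ?thesis
    by (simp add: sinh_def algebra_simps)
qed

lemma tanh_le_two_times:
  fixes t :: real
  assumes "t \<ge> 0"
  shows "tanh t \<le> 2 * t"
proof -
  have "exp t \<le> 2 * cosh t"
    by (simp add: cosh_def)
  then have "t * exp t \<le> t * (2 * cosh t)"
    using assms by (intro mult_left_mono) auto
  then have "sinh t \<le> 2 * t * cosh t"
    using sinh_le_times_exp[of t] by simp
  then show ?thesis
    by (simp add: tanh_def field_simps)
qed

lemma coth_eq_inverse_tanh: "coth t = 1 / tanh t"
  by (simp add: coth_def tanh_def)

lemma coth_ge_one:
  assumes "t > 0"
  shows "coth t \<ge> 1"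
  using assms sinh_le_cosh_real[of t] by (simp add: coth_def)

lemma coth_ge:
  assumes "t > 0"
  shows "1 / (2 * t) \<le> coth t"
  unfolding coth_eq_inverse_tanh using tanh_le_two_times[of t] assms
  by (intro divide_left_mono) auto

lemma coth_le:
  assumes "t > 0"
  shows "coth t \<le> 1 + 1 / t"
proof -
  have "exp (- t) \<le> 1" "t \<le> sinh t"
    using sinh_ge_self[of t] assms by auto
  then have "cosh t \<le> sinh t + 1"
    using cosh_minus_sinh[of t] by linarith
  then have "coth t \<le> 1 + 1 / sinh t"
    using assms by (simp add: coth_def field_simps)
  also have "\<dots> \<le> 1 + 1 / t"
    using assms \<open>t \<le> sinh t\<close> by (intro add_left_mono divide_left_mono) auto
  finally show ?thesis .
qed

text \<open>Inverting the bound on \<open>coth t\<close> gives \<open>t / (t + 1)\<close>; the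
  minimum separates linear growth on \<open>t \<le> 1\<close> from the plateau beyond.\<close>

lemma tanh_ge:
  fixes t :: real
  assumes "t > 0"
  shows "min t 1 / 2 \<le> tanh t"
proof -
  have "1 / tanh t \<le> 1 + 1 / t"
    using coth_le[OF assms] by (simp add: coth_eq_inverse_tanh)
  then have "t / (t + 1) \<le> tanh t"
    using assms by (simp add: field_simps)
  moreover have "min t 1 / 2 \<le> t / (t + 1)"
    using assms by (auto simp: min_def field_simps)
  ultimately show ?thesis by linarith
qed

section \<open>Integrals with half of the exponent\<close>

text \<open>What remains to be integrated in the upper bound: \<open>s\<close> stands for
  \<open>\<sigma> - \<nu>\<close>, the factor \<open>exp (- (\<nu> * t))\<close> comes from
  \<open>sinh (2 * t)\<close>, and 8 replaces 4 because half of the exponent is spent on the decay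
  in \<open>M\<close>.\<close>

definition half_exponent_integral :: "real \<Rightarrow> real \<Rightarrow> real \<Rightarrow> real \<Rightarrow> ennreal" where
  "half_exponent_integral \<nu> s a b =
     (\<integral>\<^sup>+t\<in>{0<..}. ennreal (t powr (s - 1) * exp (- (\<nu> * t)) *
        exp (- (tanh t * a\<^sup>2 + coth t * b\<^sup>2) / 8)) \<partial>lborel)"

text \<open>This is \<open>powr_times_exp_le\<close> in the variable \<open>r / t\<close>: the
  exponential beats the singularity at \<open>t = 0\<close>.\<close>

lemma powr_times_exp_inverse_le:
  fixes r s t :: real
  assumes "s < 1" "r > 0" "t > 0"
  shows "t powr (s - 1) * exp (- (r / (16 * t))) \<le> (16 * (1 - s)) powr (1 - s) * r powr (s - 1)"
proof -
  have "t powr (s - 1) = (r / t) powr (1 - s) * r powr (s - 1)"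
    using assms by (simp add: powr_divide powr_diff field_simps)
  then have "t powr (s - 1) * exp (- (r / (16 * t)))
      = ((r / t) powr (1 - s) * exp (- (1 / 16 * (r / t)))) * r powr (s - 1)"
    by simp
  also have "\<dots> \<le> ((1 - s) / (1 / 16)) powr (1 - s) * r powr (s - 1)"
    using assms by (intro mult_right_mono powr_times_exp_le) auto
  finally show ?thesis by (simp add: mult.commute)
qed

text \<open>The lower cutoff, at \<open>t\<close> of order \<open>b\<^sup>2\<close>. Only the
  \<open>coth\<close> term is kept; 16 is the 8 of the exponent times the 2 in
  \<open>coth t \<ge> 1 / (2 * t)\<close>.\<close>

lemma half_exponent_le_diagonal:
  fixes t :: real
  assumes "t > 0" "\<nu> > 0"
  shows "exp (- (\<nu> * t)) * exp (- (tanh t * a\<^sup>2 + coth t * b\<^sup>2) / 8) \<le> exp (- (b\<^sup>2 / (16 * t)))"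
proof -
  have "1 / (2 * t) * b\<^sup>2 \<le> coth t * b\<^sup>2"
    using coth_ge[OF assms(1)] by (intro mult_right_mono) auto
  moreover have "0 \<le> tanh t * a\<^sup>2" "0 \<le> \<nu> * t"
    using assms by auto
  ultimately show ?thesis
    by (simp add: exp_add[symmetric] field_simps)
qed

text \<open>The upper cutoff, at \<open>t\<close> of order \<open>1 / (1 + a\<^sup>2)\<close>. The
  first summand suffices for \<open>t \<le> 1\<close>, where \<open>tanh t \<ge> t / 2\<close>, and
  the second for \<open>t > 1\<close>, where \<open>tanh t \<ge> 1 / 2\<close>. The choice of
  \<open>k\<close> serves \<open>\<nu> * t\<close> and \<open>t * a\<^sup>2 / 16\<close> at
  once.\<close>

lemma half_exponent_le_antidiagonal:
  fixes t :: real
  assumes "t > 0" "\<nu> > 0"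
  defines "k \<equiv> min \<nu> (1 / 16)"
  shows "exp (- (\<nu> * t)) * exp (- (tanh t * a\<^sup>2 + coth t * b\<^sup>2) / 8)
    \<le> exp (- (k * (1 + a\<^sup>2) * t)) + exp (- (a\<^sup>2 / 16)) * exp (- (\<nu> * t))"
proof -
  have coth: "0 \<le> coth t * b\<^sup>2"
    using coth_ge_one[OF assms(1)] by (intro mult_nonneg_nonneg) auto
  have tanh: "min t 1 / 2 * a\<^sup>2 \<le> tanh t * a\<^sup>2"
    using tanh_ge[OF assms(1)] by (intro mult_right_mono) auto
  show ?thesis
  proof (cases "t \<le> 1")
    case True
    have "k * t \<le> \<nu> * t" "k * (t * a\<^sup>2) \<le> 1 / 16 * (t * a\<^sup>2)"
      unfolding k_def using assms by (intro mult_right_mono; simp)+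
    moreover have "t * a\<^sup>2 / 2 \<le> tanh t * a\<^sup>2"
      using tanh True by simp
    ultimately have "- (\<nu> * t) + - (tanh t * a\<^sup>2 + coth t * b\<^sup>2) / 8 \<le> - (k * t + k * (t * a\<^sup>2))"
      using coth by argo
    also have "\<dots> = - (k * (1 + a\<^sup>2) * t)"
      by (simp add: algebra_simps)
    finally have "exp (- (\<nu> * t)) * exp (- (tanh t * a\<^sup>2 + coth t * b\<^sup>2) / 8)
        \<le> exp (- (k * (1 + a\<^sup>2) * t))"
      by (simp only: exp_add[symmetric] exp_le_cancel_iff)
    then show ?thesis by (smt (verit) exp_gt_zero mult_pos_pos)
  next
    case False
    then have "a\<^sup>2 / 2 \<le> tanh t * a\<^sup>2"
      using tanh by simp
    then have "- (tanh t * a\<^sup>2 + coth t * b\<^sup>2) / 8 \<le> - (a\<^sup>2 / 16)"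
      using coth by argo
    then have "exp (- (\<nu> * t)) * exp (- (tanh t * a\<^sup>2 + coth t * b\<^sup>2) / 8)
        \<le> exp (- (a\<^sup>2 / 16)) * exp (- (\<nu> * t))"
      by (simp add: mult.commute)
    then show ?thesis by (smt (verit) exp_gt_zero)
  qed
qed

section \<open>The integral for negative, positive and zero \<open>s\<close>\<close>

lemma half_exponent_integral_neg:
  assumes "s < 0" "\<nu> > 0" "b > 0"
  shows "half_exponent_integral \<nu> s a b
    \<le> ennreal (((16 * (1 - s)) powr (1 - s) + 1 / (- s)) * (b\<^sup>2) powr s)"
proof -
  define r where "r = b\<^sup>2"
  define A where "A = (16 * (1 - s)) powr (1 - s)"
  have r: "r > 0" using assms by (simp add: r_def)
  have A: "A \<ge> 0" by (simp add: A_def)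
  \<comment> \<open>Split at \<open>t = r\<close>: below, the integrand is at most
    \<open>A * r powr (s - 1)\<close> on a set of length \<open>r\<close>; above, the pure power is
    integrated. Each part is a multiple of \<open>r powr s\<close>.\<close>
  have "half_exponent_integral \<nu> s a b \<le>
     (\<integral>\<^sup>+t. ennreal (A * r powr (s - 1)) * indicator {0..r} t
        + ennreal (t powr (s - 1)) * indicator {r..} t \<partial>lborel)"
    unfolding half_exponent_integral_def
  proof (intro nn_integral_mono)
    fix t :: real
    let ?f = "t powr (s - 1) * exp (- (\<nu> * t)) * exp (- (tanh t * a\<^sup>2 + coth t * b\<^sup>2) / 8)"
    have f: "?f \<le> t powr (s - 1) * exp (- (r / (16 * t)))" if "t > 0"
      unfolding mult.assoc r_def
      using half_exponent_le_diagonal[OF that assms(2)] by (intro mult_left_mono) auto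
    consider "t \<le> 0" | "0 < t" "t \<le> r" | "0 < t" "r < t" by linarith
    then show "ennreal ?f * indicator {0<..} t \<le> ennreal (A * r powr (s - 1)) * indicator {0..r} t
        + ennreal (t powr (s - 1)) * indicator {r..} t"
    proof cases
      case 2
      have "?f \<le> A * r powr (s - 1)"
        using order_trans[OF f[OF 2(1)] powr_times_exp_inverse_le[of s r t]] assms r 2
        unfolding A_def by simp
      with 2 show ?thesis
        by (auto intro!: add_increasing2 ennreal_leI)
    next
      case 3
      have "t powr (s - 1) * exp (- (r / (16 * t))) \<le> t powr (s - 1) * 1"
        using 3 r by (intro mult_left_mono) auto
      with f[OF 3(1)] have "?f \<le> t powr (s - 1)" by linarith
      with 3 show ?thesis
        by (auto intro!: ennreal_leI)
    qed auto
  qed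
  also have "\<dots> = (\<integral>\<^sup>+t. ennreal (A * r powr (s - 1)) * indicator {0..r} t \<partial>lborel)
     + (\<integral>\<^sup>+t\<in>{r..}. ennreal (t powr (s - 1)) \<partial>lborel)"
    by (intro nn_integral_add) auto
  also have "(\<integral>\<^sup>+t. ennreal (A * r powr (s - 1)) * indicator {0..r} t \<partial>lborel)
     = ennreal (A * r powr s)"
    using r A by (simp add: nn_integral_cmult_indicator ennreal_mult'[symmetric] powr_diff)
  also have "(\<integral>\<^sup>+t\<in>{r..}. ennreal (t powr (s - 1)) \<partial>lborel) = ennreal (- (r powr s) / s)"
    using has_integral_powr_to_inf[of "s - 1" r] assms r
    by (intro nn_integral_has_integral_lebesgue') auto
  also have "ennreal (A * r powr s) + ennreal (- (r powr s) / s) = ennreal ((A + 1 / (- s)) * r powr s)"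
    using assms A by (subst ennreal_plus[symmetric]) (auto simp: field_simps)
  finally show ?thesis by (simp add: A_def r_def)
qed

text \<open>The two summands of \<open>half_exponent_le_antidiagonal\<close> give Gamma integrals
  with rates \<open>k * (1 + a\<^sup>2)\<close> and \<open>\<nu>\<close>. The first has the claimed
  size; in the second the Gaussian in \<open>a\<close> absorbs the power.\<close>

lemma half_exponent_integral_pos:
  fixes s \<nu> :: real
  assumes "s > 0" "\<nu> > 0"
  obtains C where "C > 0" "\<And>a b. half_exponent_integral \<nu> s a b \<le> ennreal (C * (1 + a\<^sup>2) powr (- s))"
proof -
  define k where "k = min \<nu> (1 / 16)"
  have k: "k > 0" using assms by (simp add: k_def)
  define B where "B = exp (1 / 16) * (16 * s) powr s"
  define C where "C = Gamma s * (k powr (- s) + B * \<nu> powr (- s))"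
  have Gs: "Gamma s > 0" using assms by (simp add: Gamma_real_pos)
  have B: "B > 0" using assms by (simp add: B_def)
  have "C > 0" unfolding C_def using Gs B k assms by (intro mult_pos_pos add_pos_pos) auto
  moreover have "half_exponent_integral \<nu> s a b \<le> ennreal (C * (1 + a\<^sup>2) powr (- s))" for a b
  proof -
    define R where "R = 1 + a\<^sup>2"
    have R: "R \<ge> 1" by (simp add: R_def)
    have "half_exponent_integral \<nu> s a b \<le>
      (\<integral>\<^sup>+t. ennreal (t powr (s - 1) * exp (- (k * R * t))) * indicator {0<..} t
        + ennreal (exp (- (a\<^sup>2 / 16))) * (ennreal (t powr (s - 1) * exp (- (\<nu> * t))) * indicator {0<..} t) \<partial>lborel)"
      unfolding half_exponent_integral_def
    proof (intro nn_integral_mono)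
      fix t :: real
      let ?f = "t powr (s - 1) * exp (- (\<nu> * t)) * exp (- (tanh t * a\<^sup>2 + coth t * b\<^sup>2) / 8)"
      show "ennreal ?f * indicator {0<..} t \<le>
        ennreal (t powr (s - 1) * exp (- (k * R * t))) * indicator {0<..} t
        + ennreal (exp (- (a\<^sup>2 / 16))) * (ennreal (t powr (s - 1) * exp (- (\<nu> * t))) * indicator {0<..} t)"
      proof (cases "t > 0")
        case True
        have "?f \<le> t powr (s - 1) * (exp (- (k * R * t)) + exp (- (a\<^sup>2 / 16)) * exp (- (\<nu> * t)))"
          unfolding mult.assoc[of "t powr _"] k_def R_def
          using half_exponent_le_antidiagonal[OF True assms(2)] by (intro mult_left_mono) auto
        then have "ennreal ?f \<le> ennreal (t powr (s - 1) * exp (- (k * R * t))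
            + exp (- (a\<^sup>2 / 16)) * (t powr (s - 1) * exp (- (\<nu> * t))))"
          by (intro ennreal_leI) (simp add: algebra_simps)
        with True show ?thesis
          by (simp add: ennreal_mult' ennreal_plus)
      qed auto
    qed
    also have "\<dots> = ennreal (Gamma s * (k * R) powr (- s)) +
        ennreal (exp (- (a\<^sup>2 / 16))) * ennreal (Gamma s * \<nu> powr (- s))"
      using assms k R
      by (subst nn_integral_add) (auto simp: nn_integral_cmult nn_integral_Gamma_Ioi)
    also have "\<dots> = ennreal (Gamma s * (k powr (- s) * R powr (- s) + exp (- (a\<^sup>2 / 16)) * \<nu> powr (- s)))"
      using assms k R Gs
      by (simp add: powr_mult ennreal_mult'[symmetric] ennreal_plus[symmetric] algebra_simps
          del: ennreal_plus)
    also have "\<dots> \<le> ennreal (C * R powr (- s))"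
    proof (rule ennreal_leI)
      \<comment> \<open>The factor \<open>exp (1 / 16)\<close> in \<open>B\<close> pays for
        replacing \<open>a\<^sup>2\<close> by \<open>R = 1 + a\<^sup>2\<close> in the
        exponent.\<close>
      have "R powr s * exp (- (1 / 16 * R)) \<le> (s / (1 / 16)) powr s"
        using assms R by (intro powr_times_exp_le) auto
      then have "exp (1 / 16) * (R powr s * exp (- (1 / 16 * R))) \<le> B"
        by (simp add: B_def mult.commute)
      moreover have "exp (1 / 16) * exp (- (1 / 16 * R)) = exp (- (a\<^sup>2 / 16))"
        by (simp add: R_def exp_add[symmetric] field_simps)
      ultimately have "R powr s * exp (- (a\<^sup>2 / 16)) \<le> B"
        by (simp add: algebra_simps)
      then have "exp (- (a\<^sup>2 / 16)) \<le> B * R powr (- s)"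
        using R by (simp add: powr_minus field_simps)
      then have "exp (- (a\<^sup>2 / 16)) * \<nu> powr (- s) \<le> B * R powr (- s) * \<nu> powr (- s)"
        by (intro mult_right_mono) auto
      then have "Gamma s * (k powr (- s) * R powr (- s) + exp (- (a\<^sup>2 / 16)) * \<nu> powr (- s))
        \<le> Gamma s * (k powr (- s) * R powr (- s) + B * R powr (- s) * \<nu> powr (- s))"
        using Gs by (intro mult_left_mono add_left_mono) auto
      then show "Gamma s * (k powr (- s) * R powr (- s) + exp (- (a\<^sup>2 / 16)) * \<nu> powr (- s)) \<le> C * R powr (- s)"
        by (simp add: C_def algebra_simps)
    qed
    finally show ?thesis by (simp add: R_def)
  qed
  ultimately show ?thesis using that by blast
qed

lemma nn_integral_inverse_Icc:
  fixes p q :: real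
  assumes "0 < p" "p \<le> q"
  shows "(\<integral>\<^sup>+t\<in>{p..q}. ennreal (1 / t) \<partial>lborel) = ennreal (ln (q / p))"
proof -
  have "(\<integral>\<^sup>+t\<in>{p..q}. ennreal (1 / t) \<partial>lborel) = ennreal (ln q - ln p)"
    using assms by (intro nn_integral_FTC_Icc) (auto intro!: derivative_eq_intros)
  then show ?thesis using assms by (simp add: ln_div)
qed

lemma half_exponent_integral_zero:
  fixes \<nu> :: real
  assumes "\<nu> > 0"
  obtains C where "C > 0" "\<And>a b. b > 0 \<Longrightarrow>
    half_exponent_integral \<nu> 0 a b \<le> ennreal (C + max 0 (ln (1 / ((1 + a\<^sup>2) * b\<^sup>2))))"
proof -
  define k where "k = min \<nu> (1 / 16)"
  have k: "k > 0" using assms by (simp add: k_def)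
  define B where "B = exp (1 / 16) * 16 / \<nu>"
  have B: "B > 0" using assms by (simp add: B_def)
  define C where "C = 16 + (1 / k + B)"
  have "C > 0" unfolding C_def using B k assms by (intro add_pos_pos) auto
  moreover have "half_exponent_integral \<nu> 0 a b \<le> ennreal (C + max 0 (ln (1 / ((1 + a\<^sup>2) * b\<^sup>2))))"
    if "b > 0" for a b
  proof -
    define R where "R = 1 + a\<^sup>2"
    have R: "R \<ge> 1" by (simp add: R_def)
    define r where "r = b\<^sup>2"
    have r: "r > 0" using that by (simp add: r_def)
    define g where "g = (\<lambda>t. exp (- (k * R * t)) + exp (- (a\<^sup>2 / 16)) * exp (- (\<nu> * t)))"
    have g0: "g t \<ge> 0" for t by (simp add: g_def)
    \<comment> \<open>Three ranges: up to \<open>r\<close> the contribution is 16, between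
      \<open>r\<close> and \<open>1 / R\<close> it is the logarithm, and beyond \<open>1 / R\<close>
      the factor \<open>1 / t\<close> is at most \<open>R\<close> while the exponentials converge.
      For \<open>r > 1 / R\<close> the middle interval is empty.\<close>
    have "half_exponent_integral \<nu> 0 a b \<le>
      (\<integral>\<^sup>+t. ennreal (16 / r) * indicator {0..r} t + (ennreal (1 / t) * indicator {r..1 / R} t
        + (ennreal R * (ennreal (exp (- (k * R * t))) * indicator {0<..} t)
        + ennreal (R * exp (- (a\<^sup>2 / 16))) * (ennreal (exp (- (\<nu> * t))) * indicator {0<..} t))) \<partial>lborel)"
      unfolding half_exponent_integral_def
    proof (intro nn_integral_mono)
      fix t :: real
      let ?f = "t powr (0 - 1) * exp (- (\<nu> * t)) * exp (- (tanh t * a\<^sup>2 + coth t * b\<^sup>2) / 8)"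
      let ?d = "ennreal R * (ennreal (exp (- (k * R * t))) * indicator {0<..} t)
        + ennreal (R * exp (- (a\<^sup>2 / 16))) * (ennreal (exp (- (\<nu> * t))) * indicator {0<..} t)"
      have f: "?f \<le> t powr (0 - 1) * exp (- (r / (16 * t)))" if "t > 0"
        unfolding mult.assoc r_def
        using half_exponent_le_diagonal[OF that assms] by (intro mult_left_mono) auto
      consider "t \<le> 0" | "0 < t" "t \<le> r" | "0 < t" "r < t" "t \<le> 1 / R" | "0 < t" "1 / R < t" by linarith
      then show "ennreal ?f * indicator {0<..} t \<le> ennreal (16 / r) * indicator {0..r} t
        + (ennreal (1 / t) * indicator {r..1 / R} t + ?d)"
      proof cases
        case 2
        have "?f \<le> 16 / r"
          using order_trans[OF f[OF 2(1)] powr_times_exp_inverse_le[of 0 r t]] r 2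
          by (simp add: powr_minus_divide)
        with 2 show ?thesis
          by (auto intro!: add_increasing2 ennreal_leI)
      next
        case 3
        have "t powr (0 - 1) * exp (- (r / (16 * t))) \<le> t powr (0 - 1) * 1"
          using 3 r by (intro mult_left_mono) auto
        also have "\<dots> = 1 / t"
          using 3 by (simp add: powr_minus_divide)
        finally have "?f \<le> 1 / t"
          using f[OF 3(1)] by linarith
        with 3 show ?thesis
          by (auto intro!: add_increasing2[OF _ ennreal_leI])
      next
        case 4
        have "?f \<le> t powr (0 - 1) * g t"
          unfolding mult.assoc[of "t powr _"] k_def R_def g_def
          using half_exponent_le_antidiagonal[OF 4(1) assms] by (intro mult_left_mono) auto
        also have "\<dots> \<le> R * g t"
          using 4 R g0[of t] by (intro mult_right_mono) (auto simp: powr_minus field_simps)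
        finally have "ennreal ?f \<le> ennreal (R * exp (- (k * R * t)) + R * exp (- (a\<^sup>2 / 16)) * exp (- (\<nu> * t)))"
          by (intro ennreal_leI) (simp add: g_def algebra_simps)
        also have "\<dots> = ?d"
          using 4 R by (simp add: ennreal_mult' ennreal_plus)
        finally show ?thesis using 4
          by (auto intro!: add_increasing)
      qed auto
    qed
    also have "\<dots> = (\<integral>\<^sup>+t. ennreal (16 / r) * indicator {0..r} t \<partial>lborel)
        + ((\<integral>\<^sup>+t. ennreal (1 / t) * indicator {r..1 / R} t \<partial>lborel)
        + ((\<integral>\<^sup>+t. ennreal R * (ennreal (exp (- (k * R * t))) * indicator {0<..} t) \<partial>lborel)
        + (\<integral>\<^sup>+t. ennreal (R * exp (- (a\<^sup>2 / 16))) * (ennreal (exp (- (\<nu> * t))) * indicator {0<..} t) \<partial>lborel)))"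
      by (subst nn_integral_add, simp, simp)+ simp
    also have "\<dots> \<le> ennreal 16 + (ennreal (max 0 (ln (1 / (R * r)))) + (ennreal (1 / k) + ennreal B))"
    proof (intro add_mono)
      show "(\<integral>\<^sup>+t. ennreal (16 / r) * indicator {0..r} t \<partial>lborel) \<le> ennreal 16"
        using r by (simp add: nn_integral_cmult_indicator ennreal_mult'[symmetric])
      show "(\<integral>\<^sup>+t. ennreal (1 / t) * indicator {r..1 / R} t \<partial>lborel) \<le> ennreal (max 0 (ln (1 / (R * r))))"
      proof (cases "r \<le> 1 / R")
        case True
        then show ?thesis
          using nn_integral_inverse_Icc[OF r True] by (auto intro!: ennreal_leI)
      qed simp
      show "(\<integral>\<^sup>+t. ennreal R * (ennreal (exp (- (k * R * t))) * indicator {0<..} t) \<partial>lborel) \<le> ennreal (1 / k)"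
        using k R by (simp add: nn_integral_cmult nn_integral_exp_Ioi ennreal_mult'[symmetric])
      have "R powr 1 * exp (- (1 / 16 * R)) \<le> (1 / (1 / 16)) powr 1"
        using R by (intro powr_times_exp_le) auto
      then have "exp (1 / 16) * (R * exp (- (1 / 16 * R))) \<le> exp (1 / 16) * 16"
        using R by simp
      also have "exp (1 / 16) * (R * exp (- (1 / 16 * R))) = R * exp (- (a\<^sup>2 / 16))"
        by (simp add: R_def exp_add[symmetric] field_simps)
      finally have "R * exp (- (a\<^sup>2 / 16)) \<le> exp (1 / 16) * 16" .
      then have "R * exp (- (a\<^sup>2 / 16)) * (1 / \<nu>) \<le> B"
        using assms by (simp add: B_def divide_right_mono)
      then show "(\<integral>\<^sup>+t. ennreal (R * exp (- (a\<^sup>2 / 16))) * (ennreal (exp (- (\<nu> * t))) * indicator {0<..} t) \<partial>lborel)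
          \<le> ennreal B"
        using assms R
        by (simp add: nn_integral_cmult nn_integral_exp_Ioi ennreal_mult'[symmetric] ennreal_leI)
    qed
    also have "\<dots> = ennreal (C + max 0 (ln (1 / (R * r))))"
      using k B by (simp add: C_def ennreal_plus[symmetric] algebra_simps
          del: ennreal_plus ennreal_numeral)
    finally show ?thesis by (simp add: R_def r_def)
  qed
  ultimately show ?thesis using that by blast
qed

section \<open>Reduction to two radial variables\<close>

text \<open>The factor \<open>1 / Gamma \<sigma>\<close> is left out and half the dimension becomes
  a real parameter \<open>\<nu>\<close>, so that the three regimes are treated over the
  reals.\<close>

definition radial_potential :: "real \<Rightarrow> real \<Rightarrow> real \<Rightarrow> real \<Rightarrow> ennreal" where
  "radial_potential \<nu> \<sigma> a b =
     (\<integral>\<^sup>+t\<in>{0<..}. ennreal ((2 * pi * sinh (2 * t)) powr (- \<nu>) *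
        exp (- (1 / 4) * (tanh t * a\<^sup>2 + coth t * b\<^sup>2)) * t powr (\<sigma> - 1)) \<partial>lborel)"

lemma potential_kernel_eq_radial:
  fixes x y :: "real ^ 'n"
  shows "potential_kernel \<sigma> x y =
    ennreal (1 / Gamma \<sigma>) * radial_potential (real CARD('n) / 2) \<sigma> (norm (x + y)) (norm (x - y))"
  by (simp add: potential_kernel_def radial_potential_def mehler_kernel_def)

text \<open>A bound free of \<open>t\<close>, which lets the decay in \<open>M\<close> be pulled out
  of the integral: \<open>t\<close> cancels in the product of the two terms, and
  \<open>coth t \<ge> 1\<close> supplies \<open>b\<^sup>2\<close>.\<close>

lemma tanh_coth_form_ge:
  fixes a b t :: real
  assumes "t > 0"
  shows "2 / 3 * (a * b + b\<^sup>2) \<le> tanh t * a\<^sup>2 + coth t * b\<^sup>2"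
proof -
  have T: "tanh t > 0" using assms by simp
  \<comment> \<open>AM-GM, as \<open>tanh t * coth t = 1\<close>\<close>
  have "0 \<le> (tanh t * a - b)\<^sup>2 / tanh t"
    using T by simp
  also have "\<dots> = tanh t * a\<^sup>2 + coth t * b\<^sup>2 - 2 * (a * b)"
    unfolding coth_eq_inverse_tanh using T by (simp add: field_simps power2_eq_square)
  finally have "2 * (a * b) \<le> tanh t * a\<^sup>2 + coth t * b\<^sup>2" by simp
  moreover have "b\<^sup>2 \<le> coth t * b\<^sup>2"
    using mult_right_mono[OF coth_ge_one[OF assms], of "b\<^sup>2"] by simp
  moreover have "0 \<le> tanh t * a\<^sup>2"
    using T by simp
  \<comment> \<open>One third of the bound by \<open>2 * (a * b)\<close> plus two thirds of the
    bound by \<open>b\<^sup>2\<close>.\<close>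
  ultimately show ?thesis by argo
qed

lemma radial_potential_le:
  assumes "\<nu> > 0" "M \<le> a * b + b\<^sup>2"
  shows "radial_potential \<nu> \<sigma> a b \<le>
    ennreal ((2 * pi) powr (- \<nu>) * exp (- (M / 12))) * half_exponent_integral \<nu> (\<sigma> - \<nu>) a b"
proof -
  have "radial_potential \<nu> \<sigma> a b \<le>
    (\<integral>\<^sup>+t. ennreal ((2 * pi) powr (- \<nu>) * exp (- (M / 12))) *
      (ennreal (t powr (\<sigma> - \<nu> - 1) * exp (- (\<nu> * t)) *
        exp (- (tanh t * a\<^sup>2 + coth t * b\<^sup>2) / 8)) * indicator {0<..} t) \<partial>lborel)"
    unfolding radial_potential_def
  proof (intro nn_integral_mono)
    fix t :: real
    let ?E = "tanh t * a\<^sup>2 + coth t * b\<^sup>2"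
    show "ennreal ((2 * pi * sinh (2 * t)) powr (- \<nu>) * exp (- (1 / 4) * ?E) * t powr (\<sigma> - 1)) *
        indicator {0<..} t \<le> ennreal ((2 * pi) powr (- \<nu>) * exp (- (M / 12))) *
      (ennreal (t powr (\<sigma> - \<nu> - 1) * exp (- (\<nu> * t)) * exp (- ?E / 8)) * indicator {0<..} t)"
    proof (cases "t > 0")
      case True
      have "(2 * pi * sinh (2 * t)) powr (- \<nu>) \<le> (2 * pi * (t * exp t)) powr (- \<nu>)"
        using sinh_double_ge[OF True] True assms by (intro powr_mono2') auto
      also have "\<dots> = (2 * pi) powr (- \<nu>) * (t powr (- \<nu>) * exp (- (\<nu> * t)))"
        using True by (simp add: powr_mult exp_powr_real mult_ac)
      finally have 1: "(2 * pi * sinh (2 * t)) powr (- \<nu>) \<le> \<dots>" .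
      \<comment> \<open>One eighth of \<open>?E\<close> is at least \<open>M / 12\<close>, as
        \<open>2 / 3 / 8 = 1 / 12\<close>; the other eighth stays under the integral.\<close>
      have "- (1 / 4) * ?E \<le> - (M / 12) + - ?E / 8"
        using tanh_coth_form_ge[OF True, of a b] assms by argo
      then have "exp (- (1 / 4) * ?E) \<le> exp (- (M / 12) + - ?E / 8)"
        by (simp only: exp_le_cancel_iff)
      also have "\<dots> = exp (- (M / 12)) * exp (- ?E / 8)" by (rule exp_add)
      finally have 2: "exp (- (1 / 4) * ?E) \<le> \<dots>" .
      have "(2 * pi * sinh (2 * t)) powr (- \<nu>) * exp (- (1 / 4) * ?E) * t powr (\<sigma> - 1)
         \<le> (2 * pi) powr (- \<nu>) * (t powr (- \<nu>) * exp (- (\<nu> * t))) *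
            (exp (- (M / 12)) * exp (- ?E / 8)) * t powr (\<sigma> - 1)"
        by (intro mult_mono 1 2) auto
      also have "\<dots> = (2 * pi) powr (- \<nu>) * exp (- (M / 12)) *
          (t powr (\<sigma> - \<nu> - 1) * exp (- (\<nu> * t)) * exp (- ?E / 8))"
        using powr_add[of t "\<sigma> - 1" "- \<nu>"] by (simp add: algebra_simps)
      finally show ?thesis
        using True by (simp add: ennreal_mult'[symmetric] ennreal_leI)
    qed auto
  qed
  also have "\<dots> = ennreal ((2 * pi) powr (- \<nu>) * exp (- (M / 12))) * half_exponent_integral \<nu> (\<sigma> - \<nu>) a b"
    unfolding half_exponent_integral_def
    by (intro nn_integral_cmult) (simp add: tanh_def coth_def sinh_field_def cosh_field_def)
  finally show ?thesis .
qed

section \<open>Lower bounds by restriction to a window in \<open>t\<close>\<close>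

lemma radial_potential_ge:
  assumes "\<nu> > 0" "0 < p" "p \<le> q"
    and L: "2 * \<nu> * q + (2 * q * a\<^sup>2 + b\<^sup>2 + b\<^sup>2 / p) / 4 \<le> L"
  shows "ennreal ((4 * pi) powr (- \<nu>) * exp (- L)) * (\<integral>\<^sup>+t\<in>{p..q}. ennreal (t powr (\<sigma> - \<nu> - 1)) \<partial>lborel)
    \<le> radial_potential \<nu> \<sigma> a b"
proof -
  have "ennreal ((4 * pi) powr (- \<nu>) * exp (- L)) * (\<integral>\<^sup>+t\<in>{p..q}. ennreal (t powr (\<sigma> - \<nu> - 1)) \<partial>lborel)
    = (\<integral>\<^sup>+t. ennreal ((4 * pi) powr (- \<nu>) * exp (- L)) *
        (ennreal (t powr (\<sigma> - \<nu> - 1)) * indicator {p..q} t) \<partial>lborel)"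
    by (intro nn_integral_cmult[symmetric]) auto
  also have "\<dots> \<le> radial_potential \<nu> \<sigma> a b"
    unfolding radial_potential_def
  proof (intro nn_integral_mono)
    fix t :: real
    let ?E = "tanh t * a\<^sup>2 + coth t * b\<^sup>2"
    show "ennreal ((4 * pi) powr (- \<nu>) * exp (- L)) * (ennreal (t powr (\<sigma> - \<nu> - 1)) * indicator {p..q} t)
      \<le> ennreal ((2 * pi * sinh (2 * t)) powr (- \<nu>) * exp (- (1 / 4) * ?E) * t powr (\<sigma> - 1)) *
        indicator {0<..} t"
    proof (cases "t \<in> {p..q}")
      case True
      then have t: "t > 0" "p \<le> t" "t \<le> q" using assms by auto
      have sinh: "sinh (2 * t) > 0" using t by simp
      have "(4 * pi) powr (- \<nu>) * (t powr (- \<nu>) * exp (- (2 * \<nu> * t)))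
          = (2 * pi * (2 * t * exp (2 * t))) powr (- \<nu>)"
        using t powr_mult[of "4 * pi" "t * exp (2 * t)" "- \<nu>"]
        by (simp add: powr_mult[of t] exp_powr_real mult_ac)
      also have "\<dots> \<le> (2 * pi * sinh (2 * t)) powr (- \<nu>)"
        using sinh_le_times_exp[of "2 * t"] sinh assms by (intro powr_mono2') auto
      finally have 1: "(4 * pi) powr (- \<nu>) * (t powr (- \<nu>) * exp (- (2 * \<nu> * t))) \<le> \<dots>" .
      \<comment> \<open>The parts of \<open>L\<close>: the \<open>tanh\<close> term and the growth
        of \<open>sinh (2 * t)\<close> are bounded through the right end \<open>q\<close>, the
        \<open>coth\<close> term through the left end \<open>p\<close>.\<close>
      have "tanh t * a\<^sup>2 \<le> 2 * q * a\<^sup>2"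
        using tanh_le_two_times[of t] t by (intro mult_right_mono) auto
      moreover have "coth t * b\<^sup>2 \<le> b\<^sup>2 + b\<^sup>2 / p"
      proof -
        have "1 / t \<le> 1 / p" using t assms by (intro divide_left_mono) auto
        then have "coth t \<le> 1 + 1 / p" using coth_le[OF t(1)] by simp
        then have "coth t * b\<^sup>2 \<le> (1 + 1 / p) * b\<^sup>2" by (rule mult_right_mono) simp
        then show ?thesis by (simp add: algebra_simps)
      qed
      moreover have "2 * \<nu> * t \<le> 2 * \<nu> * q"
        using t assms by (intro mult_left_mono) auto
      ultimately have "2 * \<nu> * t + 1 / 4 * ?E \<le> L"
        using L by argo
      then have "exp (- L) \<le> exp (- (2 * \<nu> * t) + - (1 / 4) * ?E)"
        by simp
      also have "\<dots> = exp (- (2 * \<nu> * t)) * exp (- (1 / 4) * ?E)" by (rule exp_add)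
      finally have 2: "exp (- L) \<le> \<dots>" .
      have "(4 * pi) powr (- \<nu>) * exp (- L) * t powr (\<sigma> - \<nu> - 1)
        \<le> (4 * pi) powr (- \<nu>) * (exp (- (2 * \<nu> * t)) * exp (- (1 / 4) * ?E)) * t powr (\<sigma> - \<nu> - 1)"
        by (intro mult_right_mono mult_left_mono 2) auto
      also have "\<dots> = ((4 * pi) powr (- \<nu>) * (t powr (- \<nu>) * exp (- (2 * \<nu> * t)))) *
          exp (- (1 / 4) * ?E) * t powr (\<sigma> - 1)"
        using powr_add[of t "\<sigma> - 1" "- \<nu>"] by (simp add: algebra_simps)
      also have "\<dots> \<le> (2 * pi * sinh (2 * t)) powr (- \<nu>) * exp (- (1 / 4) * ?E) * t powr (\<sigma> - 1)"
        by (intro mult_right_mono 1) auto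
      finally show ?thesis
        using True t by (simp add: ennreal_mult'[symmetric] ennreal_leI)
    qed auto
  qed
  finally show ?thesis .
qed

text \<open>On an interval of ratio 2 a power is comparable to its value at the left end; the
  minimum covers increasing and decreasing powers. The length \<open>\<tau>\<close> raises the
  exponent from \<open>s - 1\<close> to \<open>s\<close>.\<close>

lemma nn_integral_powr_dyadic_ge:
  fixes \<tau> s :: real
  assumes "\<tau> > 0"
  shows "ennreal (min 1 (2 powr (s - 1)) * \<tau> powr s)
    \<le> (\<integral>\<^sup>+t\<in>{\<tau>..2 * \<tau>}. ennreal (t powr (s - 1)) \<partial>lborel)"
proof -
  define m :: real where "m = min 1 (2 powr (s - 1))"
  have m: "m \<ge> 0" by (simp add: m_def)
  have "ennreal (m * \<tau> powr s) = (\<integral>\<^sup>+t. ennreal (m * \<tau> powr (s - 1)) * indicator {\<tau>..2 * \<tau>} t \<partial>lborel)"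
    using assms m by (simp add: nn_integral_cmult_indicator ennreal_mult'[symmetric] powr_diff)
  also have "\<dots> \<le> (\<integral>\<^sup>+t\<in>{\<tau>..2 * \<tau>}. ennreal (t powr (s - 1)) \<partial>lborel)"
  proof (intro nn_integral_mono)
    fix t :: real
    have "m * \<tau> powr (s - 1) \<le> t powr (s - 1)" if t: "\<tau> \<le> t" "t \<le> 2 * \<tau>"
    proof (cases "s \<ge> 1")
      case True
      have "m * \<tau> powr (s - 1) \<le> 1 * \<tau> powr (s - 1)"
        unfolding m_def by (intro mult_right_mono) auto
      also have "\<dots> \<le> t powr (s - 1)"
        using True assms t by (simp add: powr_mono2)
      finally show ?thesis .
    next
      case False
      have "m * \<tau> powr (s - 1) \<le> 2 powr (s - 1) * \<tau> powr (s - 1)"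
        unfolding m_def by (intro mult_right_mono) auto
      also have "\<dots> = (2 * \<tau>) powr (s - 1)"
        using assms by (simp add: powr_mult)
      also have "\<dots> \<le> t powr (s - 1)"
        using False assms t by (intro powr_mono2') auto
      finally show ?thesis .
    qed
    then show "ennreal (m * \<tau> powr (s - 1)) * indicator {\<tau>..2 * \<tau>} t
       \<le> ennreal (t powr (s - 1)) * indicator {\<tau>..2 * \<tau>} t"
      by (auto simp: indicator_def intro!: ennreal_leI)
  qed
  finally show ?thesis by (simp add: m_def)
qed

lemma radial_potential_ge_dyadic:
  assumes "\<nu> > 0" "\<tau> > 0"
    and "4 * \<nu> * \<tau> + (4 * \<tau> * a\<^sup>2 + b\<^sup>2 + b\<^sup>2 / \<tau>) / 4 \<le> L"
  shows "ennreal ((4 * pi) powr (- \<nu>) * exp (- L) * (min 1 (2 powr (\<sigma> - \<nu> - 1)) * \<tau> powr (\<sigma> - \<nu>)))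
    \<le> radial_potential \<nu> \<sigma> a b"
proof -
  have "ennreal ((4 * pi) powr (- \<nu>) * exp (- L) * (min 1 (2 powr (\<sigma> - \<nu> - 1)) * \<tau> powr (\<sigma> - \<nu>)))
    = ennreal ((4 * pi) powr (- \<nu>) * exp (- L)) * ennreal (min 1 (2 powr (\<sigma> - \<nu> - 1)) * \<tau> powr (\<sigma> - \<nu>))"
    by (rule ennreal_mult') simp
  also have "\<dots> \<le> ennreal ((4 * pi) powr (- \<nu>) * exp (- L)) *
      (\<integral>\<^sup>+t\<in>{\<tau>..2 * \<tau>}. ennreal (t powr (\<sigma> - \<nu> - 1)) \<partial>lborel)"
    using assms by (intro mult_left_mono nn_integral_powr_dyadic_ge) auto
  also have "\<dots> \<le> radial_potential \<nu> \<sigma> a b"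
    using assms by (intro radial_potential_ge) auto
  finally show ?thesis .
qed

text \<open>On this window the exponent is bounded and \<open>t \<le> 1\<close>, so
  \<open>t powr (\<sigma> - \<nu> - 1)\<close> is at least \<open>1 / t\<close> for every
  \<open>\<sigma> \<le> \<nu>\<close>. One logarithmic bound thus serves the critical case and the
  whole divergence on the diagonal.\<close>

lemma radial_potential_ge_ln:
  assumes "\<nu> > 0" "0 < p" "p \<le> 1 / (1 + a\<^sup>2)" "b\<^sup>2 \<le> p" "\<sigma> \<le> \<nu>"
  shows "ennreal ((4 * pi) powr (- \<nu>) * exp (- (2 * \<nu> + 1)) * ln (1 / ((1 + a\<^sup>2) * p)))
    \<le> radial_potential \<nu> \<sigma> a b"
proof -
  define q where "q = 1 / (1 + a\<^sup>2)"
  have R: "1 + a\<^sup>2 \<ge> 1" by simp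
  have q: "0 < q" "q \<le> 1" "q * a\<^sup>2 \<le> 1"
    using R by (simp_all add: q_def field_simps add_pos_nonneg)
  have pq: "p \<le> q" using assms by (simp add: q_def)
  have "b\<^sup>2 / p \<le> 1" using assms by simp
  moreover have "2 * \<nu> * q \<le> 2 * \<nu> * 1"
    using assms q by (intro mult_left_mono) auto
  \<comment> \<open>The 1 is \<open>(2 + 1 + 1) / 4\<close>, from
    \<open>q * a\<^sup>2 \<le> 1\<close>, \<open>b\<^sup>2 \<le> p \<le> q \<le> 1\<close> and
    \<open>b\<^sup>2 / p \<le> 1\<close>.\<close>
  ultimately have L: "2 * \<nu> * q + (2 * q * a\<^sup>2 + b\<^sup>2 + b\<^sup>2 / p) / 4 \<le> 2 * \<nu> + 1"
    using assms pq q by (simp only: mult.assoc) argo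
  have "ennreal ((4 * pi) powr (- \<nu>) * exp (- (2 * \<nu> + 1)) * ln (q / p))
    = ennreal ((4 * pi) powr (- \<nu>) * exp (- (2 * \<nu> + 1))) * ennreal (ln (q / p))"
    by (rule ennreal_mult') simp
  also have "\<dots> = ennreal ((4 * pi) powr (- \<nu>) * exp (- (2 * \<nu> + 1))) *
      (\<integral>\<^sup>+t\<in>{p..q}. ennreal (1 / t) \<partial>lborel)"
    using assms pq by (simp add: nn_integral_inverse_Icc)
  also have "\<dots> \<le> ennreal ((4 * pi) powr (- \<nu>) * exp (- (2 * \<nu> + 1))) *
      (\<integral>\<^sup>+t\<in>{p..q}. ennreal (t powr (\<sigma> - \<nu> - 1)) \<partial>lborel)"
  proof (intro mult_left_mono nn_integral_mono)
    fix t :: real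
    have "1 / t \<le> t powr (\<sigma> - \<nu> - 1)" if "p \<le> t" "t \<le> q"
    proof -
      have "t powr (- 1) \<le> t powr (\<sigma> - \<nu> - 1)"
        using that assms q by (intro powr_mono') auto
      then show ?thesis using that assms by (simp add: powr_minus_divide)
    qed
    then show "ennreal (1 / t) * indicator {p..q} t \<le> ennreal (t powr (\<sigma> - \<nu> - 1)) * indicator {p..q} t"
      by (auto simp: indicator_def intro!: ennreal_leI)
  qed simp
  also have "\<dots> \<le> radial_potential \<nu> \<sigma> a b"
    using assms pq L by (intro radial_potential_ge) auto
  finally show ?thesis by (simp add: q_def)
qed

lemma radial_potential_diagonal:
  assumes "\<nu> > 0" "\<sigma> \<le> \<nu>"
  shows "radial_potential \<nu> \<sigma> a 0 = \<infinity>"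
proof (rule ccontr)
  assume "radial_potential \<nu> \<sigma> a 0 \<noteq> \<infinity>"
  then obtain X where X: "X \<ge> 0" "radial_potential \<nu> \<sigma> a 0 = ennreal X"
    by (cases "radial_potential \<nu> \<sigma> a 0") auto
  define k where "k = (4 * pi) powr (- \<nu>) * exp (- (2 * \<nu> + 1))"
  have k: "k > 0" by (simp add: k_def)
  define R where "R = 1 + a\<^sup>2"
  have R: "R > 0" by (simp add: R_def add_pos_nonneg)
  \<comment> \<open>For \<open>b = 0\<close> the left end may be arbitrarily small; this one makes
    the logarithm \<open>(X + 1) / k\<close>, so the lower bound exceeds the supposed value
    \<open>X\<close>.\<close>
  define p where "p = exp (- ((X + 1) / k)) / R"
  have "exp (- ((X + 1) / k)) \<le> 1" using k X by simp
  then have p: "0 < p" "p \<le> 1 / R"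
    using R by (simp_all add: p_def divide_right_mono)
  have "1 / (R * p) = exp ((X + 1) / k)"
    using R by (simp add: p_def exp_minus field_simps)
  then have "ennreal (k * ((X + 1) / k)) \<le> radial_potential \<nu> \<sigma> a 0"
    using radial_potential_ge_ln[of \<nu> p a 0 \<sigma>] assms p by (simp add: R_def k_def)
  then have "X + 1 \<le> X" using X k by (simp add: ennreal_le_iff)
  then show False by simp
qed

section \<open>The three regimes\<close>

lemma power2_powr:
  fixes x r :: real
  assumes "x \<ge> 0"
  shows "(x\<^sup>2) powr r = x powr (2 * r)"
  using powr_powr[of x 2 r] assms by simp

section \<open>Upper bounds below, above and at the critical exponent\<close>

lemma radial_potential_le_subcritical:
  assumes "\<nu> > 0" "\<sigma> < \<nu>"
  obtains C where "C > 0" "\<And>a b M. b > 0 \<Longrightarrow> M \<le> a * b + b\<^sup>2 \<Longrightarrow>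
    radial_potential \<nu> \<sigma> a b \<le> ennreal (C * b powr (2 * \<sigma> - 2 * \<nu>) * exp (- (M / 12)))"
proof -
  define s where "s = \<sigma> - \<nu>"
  define A where "A = (16 * (1 - s)) powr (1 - s) + 1 / (- s)"
  have "A > 0" unfolding A_def using assms by (intro add_nonneg_pos) (auto simp: s_def)
  show ?thesis
  proof
    show "(2 * pi) powr (- \<nu>) * A > 0" using \<open>A > 0\<close> by simp
    fix a b M :: real
    assume b: "b > 0" and M: "M \<le> a * b + b\<^sup>2"
    have "(b\<^sup>2) powr s = b powr (2 * \<sigma> - 2 * \<nu>)"
      using b by (simp add: s_def power2_powr algebra_simps)
    then have "half_exponent_integral \<nu> s a b \<le> ennreal (A * b powr (2 * \<sigma> - 2 * \<nu>))"
      using half_exponent_integral_neg[of s \<nu> b a] assms b by (simp add: A_def s_def)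
    then have "radial_potential \<nu> \<sigma> a b \<le> ennreal ((2 * pi) powr (- \<nu>) * exp (- (M / 12))) *
        ennreal (A * b powr (2 * \<sigma> - 2 * \<nu>))"
      by (intro order_trans[OF radial_potential_le[OF assms(1) M]] mult_left_mono) (auto simp: s_def)
    then show "radial_potential \<nu> \<sigma> a b
        \<le> ennreal ((2 * pi) powr (- \<nu>) * A * b powr (2 * \<sigma> - 2 * \<nu>) * exp (- (M / 12)))"
      by (subst (asm) ennreal_mult'[symmetric]) (simp_all add: mult_ac)
  qed
qed

lemma radial_potential_le_supercritical:
  assumes "\<nu> > 0" "\<nu> < \<sigma>"
  obtains C where "C > 0" "\<And>a b M. a \<ge> 0 \<Longrightarrow> M \<le> a * b + b\<^sup>2 \<Longrightarrow>
    radial_potential \<nu> \<sigma> a b \<le> ennreal (C * (1 + a) powr (2 * \<nu> - 2 * \<sigma>) * exp (- (M / 12)))"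
proof -
  define s where "s = \<sigma> - \<nu>"
  have s: "s > 0" using assms by (simp add: s_def)
  obtain A where A: "A > 0"
    "\<And>a b. half_exponent_integral \<nu> s a b \<le> ennreal (A * (1 + a\<^sup>2) powr (- s))"
    by (rule half_exponent_integral_pos[OF s assms(1)]) blast
  show ?thesis
  proof
    show "(2 * pi) powr (- \<nu>) * A * 2 powr s > 0" using \<open>A > 0\<close> by simp
    fix a b M :: real
    assume a: "a \<ge> 0" and M: "M \<le> a * b + b\<^sup>2"
    \<comment> \<open>Passing from \<open>1 + a\<^sup>2\<close> to \<open>(1 + a)\<^sup>2\<close>
      costs the factor \<open>2 powr s\<close>.\<close>
    have "0 \<le> (a - 1)\<^sup>2" by simp
    then have "(1 + a)\<^sup>2 / 2 \<le> 1 + a\<^sup>2"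
      by (simp add: power2_eq_square algebra_simps)
    then have "(1 + a\<^sup>2) powr (- s) \<le> ((1 + a)\<^sup>2 / 2) powr (- s)"
      using s a by (intro powr_mono2') auto
    also have "\<dots> = 2 powr s * (1 + a) powr (2 * - s)"
      using a by (simp add: powr_divide power2_powr powr_minus_divide)
    also have "2 * - s = 2 * \<nu> - 2 * \<sigma>" by (simp add: s_def)
    finally have "ennreal (A * (1 + a\<^sup>2) powr (- s)) \<le> ennreal (A * (2 powr s * (1 + a) powr (2 * \<nu> - 2 * \<sigma>)))"
      using A by (intro ennreal_leI mult_left_mono) auto
    from order_trans[OF A(2)[of a b] this]
    have "radial_potential \<nu> \<sigma> a b \<le> ennreal ((2 * pi) powr (- \<nu>) * exp (- (M / 12))) *
        ennreal (A * (2 powr s * (1 + a) powr (2 * \<nu> - 2 * \<sigma>)))"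
      by (intro order_trans[OF radial_potential_le[OF assms(1) M]] mult_left_mono) (auto simp: s_def)
    then show "radial_potential \<nu> \<sigma> a b
        \<le> ennreal ((2 * pi) powr (- \<nu>) * A * 2 powr s * (1 + a) powr (2 * \<nu> - 2 * \<sigma>) * exp (- (M / 12)))"
      by (subst (asm) ennreal_mult'[symmetric]) (simp_all add: mult_ac)
  qed
qed

text \<open>The integral yields the logarithm of \<open>1 / ((1 + a\<^sup>2) * b\<^sup>2)\<close>
  instead of \<open>1 / M\<close>. Since \<open>(1 + a\<^sup>2) * b\<^sup>2\<close> is at least
  \<open>M\<^sup>2 / 4\<close> for \<open>b \<le> a\<close> and at least \<open>M / 2\<close>
  otherwise, its positive part is at most \<open>ln 4\<close> plus twice the desired one.\<close>

lemma radial_potential_le_critical: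
  assumes "\<nu> > 0"
  obtains C where "C > 0" "\<And>a b M. a \<ge> 0 \<Longrightarrow> b > 0 \<Longrightarrow> M > 0 \<Longrightarrow> M \<le> a * b + b\<^sup>2 \<Longrightarrow>
    radial_potential \<nu> \<nu> a b \<le> ennreal (C * (1 + max (ln (1 / M)) 0) * exp (- (M / 12)))"
proof -
  obtain A where A: "A > 0"
    "\<And>a b. b > 0 \<Longrightarrow>
      half_exponent_integral \<nu> 0 a b \<le> ennreal (A + max 0 (ln (1 / ((1 + a\<^sup>2) * b\<^sup>2))))"
    by (rule half_exponent_integral_zero[OF assms]) blast
  define B where "B = A + ln 4 + 2"
  have B: "B > 0" using A by (simp add: B_def add_pos_nonneg)
  show ?thesis
  proof
    show "(2 * pi) powr (- \<nu>) * B > 0" using B by simp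
    fix a b M :: real
    assume a: "a \<ge> 0" and b: "b > 0" and M0: "M > 0" and M: "M \<le> a * b + b\<^sup>2"
    define R where "R = (1 + a\<^sup>2) * b\<^sup>2"
    define l where "l = max (ln (1 / M)) 0"
    \<comment> \<open>Its logarithm is the positive part \<open>l\<close>, and
      \<open>m \<le> m\<^sup>2\<close> lets both cases below end in the same inequality.\<close>
    define m where "m = max 1 (1 / M)"
    have m: "m \<ge> 1" "1 \<le> m * M" "m \<le> m\<^sup>2"
      using M0 by (auto simp: m_def max_def power2_eq_square field_simps)
    have l: "l = ln m" using M0 by (auto simp: l_def m_def max_def ln_div)
    have R: "R > 0" using b by (simp add: R_def add_pos_nonneg)
    have Rab: "(a * b)\<^sup>2 \<le> R" "b\<^sup>2 \<le> R"
      by (simp_all add: R_def power_mult_distrib algebra_simps)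
    have "1 \<le> 4 * m\<^sup>2 * R"
    proof (cases "b \<le> a")
      case True
      then have "M \<le> 2 * (a * b)"
        using M b by (simp add: power2_eq_square) (smt (verit) mult_right_mono)
      then have "1 \<le> m * (2 * (a * b))"
        using m mult_left_mono[of M "2 * (a * b)" m] by linarith
      then have "1\<^sup>2 \<le> (m * (2 * (a * b)))\<^sup>2"
        by (intro power_mono) auto
      also have "\<dots> = 4 * m\<^sup>2 * (a * b)\<^sup>2"
        by (simp add: power_mult_distrib)
      also have "\<dots> \<le> 4 * m\<^sup>2 * R"
        using Rab by (intro mult_left_mono) auto
      finally show ?thesis by simp
    next
      case False
      then have "M \<le> 2 * b\<^sup>2"
        using M b by (simp add: power2_eq_square) (smt (verit) mult_right_mono)
      then have "M \<le> 2 * R" using Rab by linarith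
      then have "1 \<le> m * (2 * R)"
        using m mult_left_mono[of M "2 * R" m] by linarith
      also have "\<dots> \<le> m\<^sup>2 * (4 * R)"
        using m R by (intro mult_mono) auto
      finally show ?thesis by (simp add: mult_ac)
    qed
    then have "1 / R \<le> 4 * m\<^sup>2"
      using R by (simp add: field_simps)
    then have "ln (1 / R) \<le> ln (4 * m\<^sup>2)"
      using R m by (subst ln_le_cancel_iff) (auto intro: mult_pos_pos)
    also have "\<dots> = ln 4 + 2 * l"
      using m by (simp add: l ln_mult ln_realpow)
    finally have "max 0 (ln (1 / R)) \<le> ln 4 + 2 * l"
      using m by (simp add: l)
    moreover have "0 \<le> (A + ln 4) * l"
      using A m by (intro mult_nonneg_nonneg) (auto simp: l add_nonneg_nonneg)
    ultimately have "A + max 0 (ln (1 / R)) \<le> B * (1 + l)"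
      by (simp add: B_def algebra_simps)
    then have "half_exponent_integral \<nu> (\<nu> - \<nu>) a b \<le> ennreal (B * (1 + l))"
      using order_trans[OF A(2)[OF b, of a] ennreal_leI] by (simp add: R_def)
    then have "radial_potential \<nu> \<nu> a b \<le> ennreal ((2 * pi) powr (- \<nu>) * exp (- (M / 12))) *
        ennreal (B * (1 + l))"
      by (intro order_trans[OF radial_potential_le[OF assms(1) M]] mult_left_mono) auto
    then show "radial_potential \<nu> \<nu> a b
        \<le> ennreal ((2 * pi) powr (- \<nu>) * B * (1 + max (ln (1 / M)) 0) * exp (- (M / 12)))"
      by (subst (asm) ennreal_mult'[symmetric]) (simp_all add: l_def mult_ac)
  qed
qed

section \<open>Lower bounds below, above and at the critical exponent\<close>

lemma radial_potential_ge_subcritical: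
  assumes "\<nu> > 0" "\<sigma> < \<nu>" "b > 0" "a \<ge> 0" "a * b \<le> M" "b\<^sup>2 \<le> M"
  shows "ennreal ((4 * pi) powr (- \<nu>) * exp (- (4 * \<nu> + 1)) * min 1 (2 powr (\<sigma> - \<nu> - 1)) *
      b powr (2 * \<sigma> - 2 * \<nu>) * exp (- ((4 * \<nu> + 2) * M)))
    \<le> radial_potential \<nu> \<sigma> a b"
proof -
  \<comment> \<open>With \<open>b\<^sup>2\<close> alone, \<open>\<tau> * a\<^sup>2\<close> could
    reach \<open>M\<^sup>2\<close>. Dividing by \<open>1 + M\<close> makes it linear in
    \<open>M\<close>, and \<open>b\<^sup>2 / \<tau> = 1 + M\<close> is linear too. As
    \<open>\<sigma> < \<nu>\<close>, a smaller \<tau> only raises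
    \<open>\<tau> powr (\<sigma> - \<nu>)\<close>.\<close>
  define \<tau> where "\<tau> = b\<^sup>2 / (1 + M)"
  define L where "L = (4 * \<nu> + 2) * M + (4 * \<nu> + 1)"
  define m :: real where "m = min 1 (2 powr (\<sigma> - \<nu> - 1))"
  have M: "M \<ge> 0" using assms by (meson order_trans zero_le_power2)
  have \<tau>: "\<tau> > 0" "\<tau> \<le> b\<^sup>2"
    using assms M by (auto simp: \<tau>_def field_simps add_pos_nonneg mult_nonneg_nonneg)
  have "(a * b)\<^sup>2 \<le> M\<^sup>2"
    using assms by (intro power_mono) auto
  also have "\<dots> \<le> M * (1 + M)"
    using M by (simp add: power2_eq_square algebra_simps)
  finally have 1: "\<tau> * a\<^sup>2 \<le> M"
    using M by (simp add: \<tau>_def field_simps power_mult_distrib)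
  have 2: "b\<^sup>2 / \<tau> = 1 + M"
    using assms M by (simp add: \<tau>_def)
  have "\<nu> * \<tau> \<le> \<nu> * M"
    using assms \<tau> by (intro mult_left_mono) auto
  moreover have "L = 4 * (\<nu> * M) + 2 * M + 4 * \<nu> + 1"
    by (simp add: L_def algebra_simps)
  ultimately have "4 * \<nu> * \<tau> + (4 * \<tau> * a\<^sup>2 + b\<^sup>2 + b\<^sup>2 / \<tau>) / 4 \<le> L"
    unfolding 2 mult.assoc using 1 assms M by argo
  from radial_potential_ge_dyadic[OF assms(1) \<tau>(1) this, of \<sigma>]
  have ge: "ennreal ((4 * pi) powr (- \<nu>) * exp (- L) * (m * \<tau> powr (\<sigma> - \<nu>))) \<le> radial_potential \<nu> \<sigma> a b"
    by (simp add: m_def)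
  have "b powr (2 * \<sigma> - 2 * \<nu>) \<le> \<tau> powr (\<sigma> - \<nu>)"
  proof -
    have "b powr (2 * \<sigma> - 2 * \<nu>) = (b\<^sup>2) powr (\<sigma> - \<nu>)"
      using assms by (simp add: power2_powr algebra_simps)
    also have "\<dots> \<le> \<tau> powr (\<sigma> - \<nu>)"
      using assms \<tau> by (intro powr_mono2') auto
    finally show ?thesis .
  qed
  then have "(4 * pi) powr (- \<nu>) * exp (- L) * (m * b powr (2 * \<sigma> - 2 * \<nu>))
      \<le> (4 * pi) powr (- \<nu>) * exp (- L) * (m * \<tau> powr (\<sigma> - \<nu>))"
    by (intro mult_left_mono) (auto simp: m_def)
  from order_trans[OF ennreal_leI[OF this] ge]
  have "ennreal ((4 * pi) powr (- \<nu>) * exp (- L) * (m * b powr (2 * \<sigma> - 2 * \<nu>)))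
      \<le> radial_potential \<nu> \<sigma> a b" .
  moreover have "exp (- L) = exp (- (4 * \<nu> + 1)) * exp (- ((4 * \<nu> + 2) * M))"
    by (simp add: L_def exp_add[symmetric] algebra_simps)
  ultimately show ?thesis by (simp add: m_def mult_ac)
qed

text \<open>The case \<open>\<sigma> = \<nu>\<close> is included to supply the constant part of the
  critical bound, and \<open>b = 0\<close> to cover the diagonal for
  \<open>\<sigma> > \<nu>\<close>.\<close>

lemma radial_potential_ge_supercritical:
  assumes "\<nu> > 0" "\<nu> \<le> \<sigma>" "b \<ge> 0" "a \<ge> 0" "a * b \<le> M" "b\<^sup>2 \<le> M"
  shows "ennreal ((4 * pi) powr (- \<nu>) * exp (- (4 * \<nu> + 1)) * min 1 (2 powr (\<sigma> - \<nu> - 1)) *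
      (1 + a) powr (2 * \<nu> - 2 * \<sigma>) * exp (- ((4 * \<nu> + 2) * M)))
    \<le> radial_potential \<nu> \<sigma> a b"
proof -
  define R where "R = 1 + a\<^sup>2"
  \<comment> \<open>With \<open>1 / R\<close> alone, \<open>b\<^sup>2 / \<tau>\<close> would be
    \<open>b\<^sup>2 + (a * b)\<^sup>2\<close>, bounded only by \<open>M + M\<^sup>2\<close>. The
    factor \<open>1 + M\<close> reduces this to \<open>M\<close> and keeps
    \<open>\<tau> * a\<^sup>2\<close> below \<open>1 + M\<close>; as
    \<open>\<sigma> \<ge> \<nu>\<close>, it does not lower
    \<open>\<tau> powr (\<sigma> - \<nu>)\<close>.\<close>
  define \<tau> where "\<tau> = (1 + M) / R"
  define L where "L = (4 * \<nu> + 2) * M + (4 * \<nu> + 1)"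
  define m :: real where "m = min 1 (2 powr (\<sigma> - \<nu> - 1))"
  have M: "M \<ge> 0" using assms by (meson order_trans zero_le_power2)
  have R: "R \<ge> 1" "R \<ge> a\<^sup>2" by (auto simp: R_def)
  have \<tau>: "\<tau> > 0" "1 / R \<le> \<tau>" "\<tau> \<le> 1 + M"
    using R M mult_left_mono[OF R(1), of "1 + M"] by (auto simp: \<tau>_def field_simps)
  have 1: "\<tau> * a\<^sup>2 \<le> 1 + M"
    using mult_left_mono[OF R(2), of "1 + M"] M R by (simp add: \<tau>_def field_simps)
  have "(a * b)\<^sup>2 \<le> M\<^sup>2"
    using assms by (intro power_mono) auto
  then have "b\<^sup>2 * R \<le> M * (1 + M)"
    using assms by (simp add: R_def power2_eq_square algebra_simps)
  then have 2: "b\<^sup>2 / \<tau> \<le> M"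
    using M R by (simp add: \<tau>_def field_simps)
  have "\<nu> * \<tau> \<le> \<nu> * (1 + M)"
    using assms \<tau> by (intro mult_left_mono) auto
  moreover have "L = 4 * (\<nu> * (1 + M)) + 2 * M + 1"
    by (simp add: L_def algebra_simps)
  ultimately have "4 * \<nu> * \<tau> + (4 * \<tau> * a\<^sup>2 + b\<^sup>2 + b\<^sup>2 / \<tau>) / 4 \<le> L"
    unfolding mult.assoc using 1 2 assms M by argo
  from radial_potential_ge_dyadic[OF assms(1) \<tau>(1) this, of \<sigma>]
  have ge: "ennreal ((4 * pi) powr (- \<nu>) * exp (- L) * (m * \<tau> powr (\<sigma> - \<nu>))) \<le> radial_potential \<nu> \<sigma> a b"
    by (simp add: m_def)
  have "(1 + a) powr (2 * \<nu> - 2 * \<sigma>) \<le> \<tau> powr (\<sigma> - \<nu>)"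
  proof -
    have "(1 + a) powr (2 * \<nu> - 2 * \<sigma>) = ((1 + a)\<^sup>2) powr (\<nu> - \<sigma>)"
      using assms by (simp add: power2_powr algebra_simps)
    also have "\<dots> \<le> R powr (\<nu> - \<sigma>)"
    proof (rule powr_mono2')
      show "R \<le> (1 + a)\<^sup>2"
        using assms by (simp add: R_def power2_eq_square algebra_simps)
    qed (use assms R in auto)
    also have "\<dots> = (1 / R) powr (\<sigma> - \<nu>)"
      using R by (simp add: powr_divide powr_diff)
    also have "\<dots> \<le> \<tau> powr (\<sigma> - \<nu>)"
      using assms \<tau> R by (intro powr_mono2) auto
    finally show ?thesis .
  qed
  then have "(4 * pi) powr (- \<nu>) * exp (- L) * (m * (1 + a) powr (2 * \<nu> - 2 * \<sigma>))
      \<le> (4 * pi) powr (- \<nu>) * exp (- L) * (m * \<tau> powr (\<sigma> - \<nu>))"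
    by (intro mult_left_mono) (auto simp: m_def)
  from order_trans[OF ennreal_leI[OF this] ge]
  have "ennreal ((4 * pi) powr (- \<nu>) * exp (- L) * (m * (1 + a) powr (2 * \<nu> - 2 * \<sigma>)))
      \<le> radial_potential \<nu> \<sigma> a b" .
  moreover have "exp (- L) = exp (- (4 * \<nu> + 1)) * exp (- ((4 * \<nu> + 2) * M))"
    by (simp add: L_def exp_add[symmetric] algebra_simps)
  ultimately show ?thesis by (simp add: m_def mult_ac)
qed

text \<open>A dyadic window gives \<open>k / 2\<close> and the logarithmic one
  \<open>k * (l - 1)\<close>. The divisor 8 fits both: \<open>(1 + l) / 8\<close> is at most
  \<open>1 / 2\<close> for \<open>l \<le> 3\<close> and at most \<open>l - 1\<close> for
  \<open>l > 3\<close>.\<close>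

lemma radial_potential_ge_critical:
  assumes "\<nu> > 0" "b > 0" "a \<ge> 0" "a * b \<le> M" "b\<^sup>2 \<le> M"
  shows "ennreal ((4 * pi) powr (- \<nu>) * exp (- (4 * \<nu> + 1)) / 8 * (1 + max (ln (1 / M)) 0) *
      exp (- ((4 * \<nu> + 2) * M)))
    \<le> radial_potential \<nu> \<nu> a b"
proof -
  define k where "k = (4 * pi) powr (- \<nu>) * exp (- (4 * \<nu> + 1)) * exp (- ((4 * \<nu> + 2) * M))"
  define l where "l = max (ln (1 / M)) 0"
  have k: "k > 0" by (simp add: k_def)
  have M: "M > 0" using assms by (meson less_le_trans zero_less_power)
  have ln2: "ln 2 \<le> (1 :: real)" using ln_le_minus_one[of "2 :: real"] by simp
  have 1: "ennreal (k / 2) \<le> radial_potential \<nu> \<nu> a b"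
    using radial_potential_ge_supercritical[of \<nu> \<nu> b a M] assms
    by (simp add: k_def powr_minus_divide min_def mult_ac)
  have 2: "ennreal (k * (l - 1)) \<le> radial_potential \<nu> \<nu> a b" if "l > 1"
  proof -
    define R where "R = 1 + a\<^sup>2"
    have R: "R \<ge> 1" by (simp add: R_def)
    have l: "l = ln (1 / M)" "M < 1"
      using that M by (auto simp: l_def max_def ln_div split: if_splits intro: ccontr)
    \<comment> \<open>For \<open>M < 1\<close> this gives
      \<open>R * b\<^sup>2 = b\<^sup>2 + (a * b)\<^sup>2 \<le> 2 * M\<close>; the 2 costs
      \<open>ln 2 \<le> 1\<close>, hence \<open>l - 1\<close>.\<close>
    have "(a * b)\<^sup>2 \<le> M\<^sup>2"
      using assms by (intro power_mono) auto
    also have "\<dots> \<le> M"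
      using M l by (simp add: power2_eq_square mult_le_one)
    finally have Rb: "R * b\<^sup>2 \<le> 2 * M"
      using assms by (simp add: R_def power_mult_distrib algebra_simps)
    have Rb0: "R * b\<^sup>2 > 0" using assms R by simp
    have "ln (1 / (2 * M)) \<le> ln (1 / (R * b\<^sup>2))"
      using Rb Rb0 M by (subst ln_le_cancel_iff) (auto intro: divide_left_mono)
    moreover have "ln (1 / (2 * M)) = l - ln 2"
      using M by (simp add: l ln_div ln_mult)
    ultimately have ge: "l - 1 \<le> ln (1 / (R * b\<^sup>2))" using ln2 by linarith
    \<comment> \<open>Positivity of the logarithm means that the window from
      \<open>b\<^sup>2\<close> to \<open>1 / R\<close> is nonempty.\<close>
    then have "0 < ln (1 / (R * b\<^sup>2))" using that by linarith
    then have "1 < 1 / (R * b\<^sup>2)"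
      using Rb0 by (intro ln_gt_zero_imp_gt_one) auto
    then have "R * b\<^sup>2 \<le> 1"
      using Rb0 by (simp add: field_simps)
    then have p: "b\<^sup>2 \<le> 1 / R" using R by (simp add: field_simps)
    have "0 \<le> (4 * \<nu> + 2) * M" using assms M by simp
    then have "k \<le> (4 * pi) powr (- \<nu>) * exp (- (2 * \<nu> + 1))"
      unfolding k_def mult.assoc exp_add[symmetric] using assms by (intro mult_left_mono) auto
    then have "k * (l - 1) \<le> (4 * pi) powr (- \<nu>) * exp (- (2 * \<nu> + 1)) * ln (1 / (R * b\<^sup>2))"
      using ge that by (intro mult_mono) auto
    also have "ennreal \<dots> \<le> radial_potential \<nu> \<nu> a b"
      using radial_potential_ge_ln[of \<nu> "b\<^sup>2" a b \<nu>] assms p by (simp add: R_def)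
    finally show ?thesis by (simp add: ennreal_leI)
  qed
  have "ennreal (k / 8 * (1 + l)) \<le> radial_potential \<nu> \<nu> a b"
  proof (cases "l \<le> 3")
    case True
    then have "k / 8 * (1 + l) \<le> k / 8 * 4"
      using k by (intro mult_left_mono) auto
    then show ?thesis
      using order_trans[OF ennreal_leI 1] by simp
  next
    case False
    then have "k * ((1 + l) / 8) \<le> k * (l - 1)"
      using k by (intro mult_left_mono) auto
    then show ?thesis
      using order_trans[OF ennreal_leI 2] False by simp
  qed
  then show ?thesis by (simp add: k_def l_def mult_ac)
qed

section \<open>Return to the points \<open>x\<close> and \<open>y\<close>\<close>

lemma dist_times_norms_bounds:
  fixes x y :: "'a :: real_normed_vector"
  defines "M \<equiv> norm (x - y) * (norm x + norm y)"
  shows "(norm (x - y))\<^sup>2 \<le> M" "norm (x + y) * norm (x - y) \<le> M"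
    "M \<le> norm (x + y) * norm (x - y) + (norm (x - y))\<^sup>2"
proof -
  show "(norm (x - y))\<^sup>2 \<le> M"
    using mult_left_mono[OF norm_triangle_ineq4[of x y], of "norm (x - y)"]
    by (simp add: M_def power2_eq_square)
  show "norm (x + y) * norm (x - y) \<le> M"
    using mult_left_mono[OF norm_triangle_ineq[of x y], of "norm (x - y)"]
    by (simp add: M_def mult.commute)
  \<comment> \<open>As sum and difference of \<open>x + y\<close> and \<open>x - y\<close>, both
    \<open>2 x\<close> and \<open>2 y\<close> have norm at most
    \<open>norm (x + y) + norm (x - y)\<close>.\<close>
  have "2 * norm x = norm ((x + y) + (x - y))"
    by (simp add: scaleR_2[symmetric])
  moreover have "2 * norm y = norm ((x + y) - (x - y))"
    by (simp add: scaleR_2[symmetric])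
  ultimately have "norm x + norm y \<le> norm (x + y) + norm (x - y)"
    using norm_triangle_ineq[of "x + y" "x - y"] norm_triangle_ineq4[of "x + y" "x - y"] by linarith
  from mult_left_mono[OF this, of "norm (x - y)"]
  show "M \<le> norm (x + y) * norm (x - y) + (norm (x - y))\<^sup>2"
    by (simp add: M_def power2_eq_square algebra_simps)
qed

text \<open>The regime is fixed by \<sigma> before \<open>A\<close> and \<open>B\<close> are chosen.
  On the diagonal with \<open>\<sigma> \<le> \<nu>\<close> the value of \<open>Y_fun\<close> is
  infinite: the upper bound is trivial and the lower one is
  \<open>radial_potential_diagonal\<close>.\<close>

lemma radial_potential_bounds:
  fixes \<sigma> :: real
  defines "\<nu> \<equiv> real CARD('n::finite) / 2"
  obtains A B where "A > 0" "B > 0"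
    "\<And>x y :: real ^ 'n. radial_potential \<nu> \<sigma> (norm (x + y)) (norm (x - y)) \<le>
       ennreal A * Y_fun \<sigma> x y * ennreal (exp (- (norm (x - y) * (norm x + norm y) / 12)))"
    "\<And>x y :: real ^ 'n.
       ennreal B * Y_fun \<sigma> x y * ennreal (exp (- ((4 * \<nu> + 2) * (norm (x - y) * (norm x + norm y)))))
         \<le> radial_potential \<nu> \<sigma> (norm (x + y)) (norm (x - y))"
proof -
  have \<nu>: "\<nu> > 0" "real CARD('n) = 2 * \<nu>" by (simp_all add: \<nu>_def)
  note bounds = dist_times_norms_bounds
  have top: "ennreal C * \<infinity> * ennreal (exp r) = \<infinity>" if "C > 0" for C r
    using that by (simp add: ennreal_mult_top ennreal_top_mult)
  consider "\<sigma> < \<nu>" | "\<sigma> = \<nu>" | "\<nu> < \<sigma>" by linarith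
  then show ?thesis
  proof cases
    case 1
    have Y: "Y_fun \<sigma> x y = (if x = y then \<infinity> else ennreal (norm (x - y) powr (2 * \<sigma> - 2 * \<nu>)))"
      for x y :: "real ^ 'n"
      using 1 by (simp add: Y_fun_def ext_power_def \<nu>)
    define B where "B = (4 * pi) powr (- \<nu>) * exp (- (4 * \<nu> + 1)) * min 1 (2 powr (\<sigma> - \<nu> - 1))"
    obtain A where A: "A > 0" "\<And>a b M. b > 0 \<Longrightarrow> M \<le> a * b + b\<^sup>2 \<Longrightarrow>
        radial_potential \<nu> \<sigma> a b \<le> ennreal (A * b powr (2 * \<sigma> - 2 * \<nu>) * exp (- (M / 12)))"
      by (rule radial_potential_le_subcritical[OF \<nu>(1) 1]) blast
    show ?thesis
    proof (rule that[of A B])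
      show B: "B > 0" by (simp add: B_def)
      fix x y :: "real ^ 'n"
      show "radial_potential \<nu> \<sigma> (norm (x + y)) (norm (x - y)) \<le>
       ennreal A * Y_fun \<sigma> x y * ennreal (exp (- (norm (x - y) * (norm x + norm y) / 12)))"
        using A(1) A(2)[OF _ bounds(3)[of x y]]
        by (cases "x = y") (simp_all add: Y top ennreal_mult'[symmetric])
      show "ennreal B * Y_fun \<sigma> x y * ennreal (exp (- ((4 * \<nu> + 2) * (norm (x - y) * (norm x + norm y)))))
         \<le> radial_potential \<nu> \<sigma> (norm (x + y)) (norm (x - y))"
      proof (cases "x = y")
        case True
        then show ?thesis using radial_potential_diagonal[OF \<nu>(1), of \<sigma>] 1 by simp
      next
        case False
        then show ?thesis
          using radial_potential_ge_subcritical[OF \<nu>(1) 1 _ _ bounds(2) bounds(1), of x y] B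
          unfolding B_def[symmetric] by (simp add: Y ennreal_mult'[symmetric])
      qed
    qed (fact A)
  next
    case 2
    have Y: "Y_fun \<sigma> x y = (if x = y then \<infinity> else
        ennreal (1 + max (ln (1 / (norm (x - y) * (norm x + norm y)))) 0))" for x y :: "real ^ 'n"
    proof (cases "x = y")
      case True
      then show ?thesis
        using 2 by (simp add: Y_fun_def log_plus_def \<nu>)
    next
      case False
      \<comment> \<open>The product is at least \<open>(norm (x - y))\<^sup>2\<close>, so off the
        diagonal the division in \<open>ennreal\<close> is the real one and \<open>log_plus\<close>
        has a finite argument.\<close>
      then have "norm (x - y) * (norm x + norm y) > 0"
        using bounds(1)[of x y] by (smt (verit) zero_less_norm_iff zero_less_power right_minus_eq)
      then have "1 / ennreal (norm (x - y) * (norm x + norm y))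
          = ennreal (1 / (norm (x - y) * (norm x + norm y)))"
        by (simp add: divide_ennreal flip: ennreal_1)
      moreover have "1 / (norm (x - y) * (norm x + norm y)) \<ge> 0" by simp
      ultimately show ?thesis
        using 2 False
        by (simp only: Y_fun_def log_plus_def \<nu> ennreal_neq_top infinity_ennreal_def enn2real_ennreal
            if_False) (simp add: ennreal_plus[symmetric] flip: ennreal_1 del: ennreal_plus)
    qed
    define B where "B = (4 * pi) powr (- \<nu>) * exp (- (4 * \<nu> + 1)) / 8"
    obtain A where A: "A > 0" "\<And>a b M. a \<ge> 0 \<Longrightarrow> b > 0 \<Longrightarrow> M > 0 \<Longrightarrow> M \<le> a * b + b\<^sup>2 \<Longrightarrow>
        radial_potential \<nu> \<nu> a b \<le> ennreal (A * (1 + max (ln (1 / M)) 0) * exp (- (M / 12)))"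
      by (rule radial_potential_le_critical[OF \<nu>(1)]) blast
    show ?thesis
    proof (rule that[of A B])
      show B: "B > 0" by (simp add: B_def)
      fix x y :: "real ^ 'n"
      define M where "M = norm (x - y) * (norm x + norm y)"
      have M: "M > 0" if "x \<noteq> y"
        using that bounds(1)[of x y] unfolding M_def
        by (smt (verit) zero_less_norm_iff zero_less_power right_minus_eq)
      show "radial_potential \<nu> \<sigma> (norm (x + y)) (norm (x - y)) \<le>
       ennreal A * Y_fun \<sigma> x y * ennreal (exp (- (norm (x - y) * (norm x + norm y) / 12)))"
        unfolding Y M_def[symmetric] unfolding 2
        using A(1) A(2)[OF _ _ M bounds(3)[of x y, folded M_def]]
        by (cases "x = y") (simp_all add: top ennreal_mult'[symmetric] del: ennreal_plus)
      show "ennreal B * Y_fun \<sigma> x y * ennreal (exp (- ((4 * \<nu> + 2) * (norm (x - y) * (norm x + norm y)))))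
         \<le> radial_potential \<nu> \<sigma> (norm (x + y)) (norm (x - y))"
      proof (cases "x = y")
        case True
        then show ?thesis using radial_potential_diagonal[OF \<nu>(1), of \<sigma>] 2 by simp
      next
        case False
        then show ?thesis
          unfolding Y unfolding 2
          using radial_potential_ge_critical[OF \<nu>(1) _ _ bounds(2) bounds(1), of x y, folded B_def] B
          by (simp add: ennreal_mult'[symmetric] del: ennreal_plus)
      qed
    qed (fact A)
  next
    case 3
    have Y: "Y_fun \<sigma> x y = ennreal ((1 + norm (x + y)) powr (2 * \<nu> - 2 * \<sigma>))"
      for x y :: "real ^ 'n"
      using 3 by (simp add: Y_fun_def \<nu>)
    define B where "B = (4 * pi) powr (- \<nu>) * exp (- (4 * \<nu> + 1)) * min 1 (2 powr (\<sigma> - \<nu> - 1))"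
    obtain A where A: "A > 0" "\<And>a b M. a \<ge> 0 \<Longrightarrow> M \<le> a * b + b\<^sup>2 \<Longrightarrow>
        radial_potential \<nu> \<sigma> a b \<le> ennreal (A * (1 + a) powr (2 * \<nu> - 2 * \<sigma>) * exp (- (M / 12)))"
      by (rule radial_potential_le_supercritical[OF \<nu>(1) 3]) blast
    show ?thesis
    proof (rule that[of A B])
      show B: "B > 0" by (simp add: B_def)
      fix x y :: "real ^ 'n"
      show "radial_potential \<nu> \<sigma> (norm (x + y)) (norm (x - y)) \<le>
       ennreal A * Y_fun \<sigma> x y * ennreal (exp (- (norm (x - y) * (norm x + norm y) / 12)))"
        using A(1) A(2)[OF _ bounds(3)[of x y]]
        by (simp add: Y ennreal_mult'[symmetric])
      show "ennreal B * Y_fun \<sigma> x y * ennreal (exp (- ((4 * \<nu> + 2) * (norm (x - y) * (norm x + norm y)))))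
         \<le> radial_potential \<nu> \<sigma> (norm (x + y)) (norm (x - y))"
        using radial_potential_ge_supercritical[OF \<nu>(1) _ _ _ bounds(2) bounds(1), of \<sigma> x y] B 3
        unfolding B_def[symmetric] by (simp add: Y ennreal_mult'[symmetric])
    qed (fact A)
  qed
qed

theorem theorem2p4:
  fixes \<sigma> :: real
  assumes "\<sigma> > 0"
  shows "\<exists>C c1 c2 :: real. C > 0 \<and> c1 > 0 \<and> c2 > 0 \<and>
    (\<forall>x y :: real ^ 'n.
       ennreal (inverse C) * Y_fun \<sigma> x y *
           ennreal (exp (- c1 * norm (x - y) * (norm x + norm y)))
         \<le> potential_kernel \<sigma> x y \<and>
       potential_kernel \<sigma> x y
         \<le> ennreal C * Y_fun \<sigma> x y *
           ennreal (exp (- c2 * norm (x - y) * (norm x + norm y))))"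
proof -
  define \<nu> where "\<nu> = real CARD('n) / 2"
  obtain A B where A: "A > 0" "\<And>x y :: real ^ 'n.
       radial_potential \<nu> \<sigma> (norm (x + y)) (norm (x - y)) \<le>
       ennreal A * Y_fun \<sigma> x y * ennreal (exp (- (norm (x - y) * (norm x + norm y) / 12)))"
    and B: "B > 0" "\<And>x y :: real ^ 'n.
       ennreal B * Y_fun \<sigma> x y * ennreal (exp (- ((4 * \<nu> + 2) * (norm (x - y) * (norm x + norm y)))))
         \<le> radial_potential \<nu> \<sigma> (norm (x + y)) (norm (x - y))"
    unfolding \<nu>_def by (rule radial_potential_bounds[where 'n = 'n and \<sigma> = \<sigma>]) blast
  define g where "g = 1 / Gamma \<sigma>"
  have g: "g > 0" using assms by (simp add: g_def Gamma_real_pos)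
  \<comment> \<open>One constant for both sides: \<open>g * A \<le> C\<close> and
    \<open>inverse C \<le> g * B\<close>.\<close>
  define C where "C = max (g * A) (inverse (g * B))"
  have C: "C > 0" "g * A \<le> C" using A g by (auto simp: C_def less_max_iff_disj)
  have "inverse C \<le> inverse (inverse (g * B))"
    using g B by (intro le_imp_inverse_le) (auto simp: C_def)
  then have C': "inverse C \<le> g * B" by simp
  have K: "potential_kernel \<sigma> x y = ennreal g * radial_potential \<nu> \<sigma> (norm (x + y)) (norm (x - y))"
    for x y :: "real ^ 'n"
    by (simp add: potential_kernel_eq_radial g_def \<nu>_def)
  have "ennreal (inverse C) * Y_fun \<sigma> x y *
           ennreal (exp (- (4 * \<nu> + 2) * norm (x - y) * (norm x + norm y)))
         \<le> potential_kernel \<sigma> x y" for x y :: "real ^ 'n"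
  proof -
    let ?e = "ennreal (exp (- ((4 * \<nu> + 2) * (norm (x - y) * (norm x + norm y)))))"
    have "ennreal (inverse C) * Y_fun \<sigma> x y * ?e \<le> ennreal (g * B) * Y_fun \<sigma> x y * ?e"
      using C' by (intro mult_right_mono ennreal_leI) auto
    also have "\<dots> = ennreal g * (ennreal B * Y_fun \<sigma> x y * ?e)"
      using g by (simp add: ennreal_mult' mult.assoc)
    also have "\<dots> \<le> potential_kernel \<sigma> x y"
      unfolding K by (intro mult_left_mono B) simp
    finally show ?thesis by (simp only: mult.assoc mult_minus_left)
  qed
  moreover have "potential_kernel \<sigma> x y
         \<le> ennreal C * Y_fun \<sigma> x y * ennreal (exp (- (1 / 12) * norm (x - y) * (norm x + norm y)))"
    for x y :: "real ^ 'n"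
  proof -
    let ?e = "ennreal (exp (- (norm (x - y) * (norm x + norm y) / 12)))"
    have "potential_kernel \<sigma> x y \<le> ennreal g * (ennreal A * Y_fun \<sigma> x y * ?e)"
      unfolding K by (intro mult_left_mono A) simp
    also have "\<dots> = ennreal (g * A) * Y_fun \<sigma> x y * ?e"
      using g by (simp add: ennreal_mult' mult.assoc)
    also have "\<dots> \<le> ennreal C * Y_fun \<sigma> x y * ?e"
      using C by (intro mult_right_mono ennreal_leI) auto
    finally show ?thesis by simp
  qed
  \<comment> \<open>The witnesses are \<open>c1 = 4 * \<nu> + 2\<close>, that is
    \<open>2 * d + 2\<close>, and \<open>c2 = 1 / 12\<close>; neither depends on \<sigma>.\<close>
  moreover have "4 * \<nu> + 2 > 0" "(1 / 12 :: real) > 0" by (auto simp: \<nu>_def add_nonneg_pos)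
  ultimately show ?thesis using C(1) by blast
qed

end
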